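(* Let $a,b,c\in C(\mathbb{R}^+)$ and let $y\not\equiv 0$ be a solution of $$\dddot y(t)+a(t)\ddot y(t)+b(t)\dot y(t)+c(t)y(t)=0,\qquad t\in\mathbb{R}^+ .$$ Then for every $t>0$, $$\gamma_3(y,t)>\frac{\nu(y,t)-5}{2}\,L_{\Omega}.$$
   Context: For a solution $y$, $\nu(y,t)$ denotes the number of zeros of $y$ on $[0,t]$. Put $x(\tau)=(y(\tau),\dot y(\tau),\ddot y(\tau))\in\mathbb{R}^3$ (nonzero for all $\tau$ when $y\not\equiv0$) and $$\gamma_3(y,t)=\int_0^t\left|\frac{d}{d\tau}\left(\frac{x(\tau)}{|x(\tau)|}\right)\right|d\tau,$$ the length of the path traced by the unit vector $x(\tau)/|x(\tau)|$ on the unit sphere for $\tau\in[0,t]$ (Euclidean norm). Let $\Omega_+=\{(x_0,x_1,x_2)\in S^2:\ x_0x_2-x_1^2>0,\ x_2>0\}$ on the unit sphere $S^2\subset\mathbb{R}^3$. $L_\Omega$ is the length of the boundary of $\Omega_+$ on $S^2$; explicitly $L_{\Omega}=4\int_0^{\pi}\frac{\sqrt{5-\cos\alpha}}{7+\cos\alpha}\,d\alpha$. *)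

theory Defs
  imports "HOL-Analysis.Analysis"
begin

text \<open>The phase vector x(tau) = (y, y', y'') in R^3 (product norm = Euclidean norm).\<close>
definition phase3 :: "(real \<Rightarrow> real) \<Rightarrow> (real \<Rightarrow> real) \<Rightarrow> (real \<Rightarrow> real) \<Rightarrow> real \<Rightarrow> real \<times> real \<times> real"
  where "phase3 y y1 y2 \<tau> = (y \<tau>, y1 \<tau>, y2 \<tau>)"

definition gamma3 :: "(real \<Rightarrow> real) \<Rightarrow> (real \<Rightarrow> real) \<Rightarrow> (real \<Rightarrow> real) \<Rightarrow> real \<Rightarrow> real"
  where "gamma3 y y1 y2 t =
    integral {0..t} (\<lambda>\<tau>. norm (vector_derivative
       (\<lambda>s. phase3 y y1 y2 s /\<^sub>R norm (phase3 y y1 y2 s)) (at \<tau> within {0..t})))"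

definition nu :: "(real \<Rightarrow> real) \<Rightarrow> real \<Rightarrow> nat"
  where "nu y t = card {s \<in> {0..t}. y s = 0}"

definition L_Omega :: real
  where "L_Omega = 4 * integral {0..pi} (\<lambda>\<alpha>. sqrt (5 - cos \<alpha>) / (7 + cos \<alpha>))"

end

(* Cauchy-Crofton: a curve on the sphere has length proportional to the average, over all normals n,
   of the number of points where it crosses the plane orthogonal to n. The plane of n = (c0, c1, c2)
   cuts the cone x0 x2 = x1^2 exactly when c2 r^2 + c1 r + c0 has two distinct real roots l, m; it then
   meets the boundary of Omega_+ in two points, while along the solution the form
   c0 y + c1 y' + c2 y'' = c2 (D - l)(D - m) y changes sign at least nu - 2 times by Rolle's theorem.
   Averaging over these n alone gives gamma_3 >= (nu - 2)/2 * L_Omega.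
   Both averages are computed on inscribed polygons: the set of normals in the unit ball
   separating two unit vectors is a double wedge whose volume is proportional to their angle. *)
theory Submission
  imports Defs "HOL-Real_Asymp.Real_Asymp"
begin

section \<open>Chords and angles of curves on the sphere\<close>

text \<open>Each average enters as an inequality, and the two directions need different care. For
  the cone, crossings are bounded from above: strict sign changes at the nodes number at most two on
  every polygon, so the bound passes to the limit at once. For the solution they are bounded from
  below, and how fine a grid must be to show all sign changes depends on the normal; weak sign
  changes and Fatou's lemma deal with that. Normals fill a ball rather than a sphere so that
  Lebesgue measure and its invariance under orthogonal maps apply; the factor
  \<open>lune_const\<close> between volume and angle enters both averages and cancels. Rolle's
  theorem is applied twice, but the zeros of \<open>y1 - l * y\<close> need not be isolated. The
  proof therefore alternates between zeros separated by a nonzero value and strict sign changes. The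
  averages give a weak inequality; strictness comes from the gap between 2 and 5, as
  \<open>L_Omega\<close> is positive. Since \<open>nu\<close> is a cardinality, an infinite zero set
  counts as 0.\<close>

lemma sin_ge_cubic: "x - x^3 / 6 \<le> sin x" if "0 \<le> x" for x :: real
proof -
  have "\<bar>sin x - (\<Sum>m<3. sin_coeff m * x ^ m)\<bar> \<le> inverse (fact 3) * \<bar>x\<bar> ^ 3"
    by (rule Maclaurin_sin_bound)
  moreover have "(\<Sum>m<3. sin_coeff m * x ^ m) = x"
    by (simp add: eval_nat_numeral sin_coeff_def)
  ultimately have "\<bar>sin x - x\<bar> \<le> x ^ 3 / 6"
    using that by (simp add: fact_numeral)
  then show ?thesis
    by linarith
qed

lemma chord_eq_sin_half_angle:
  fixes p q :: "'a::real_inner"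
  assumes "norm p = 1" "norm q = 1"
  shows "norm (q - p) = 2 * sin (arccos (p \<bullet> q) / 2)"
    and "0 \<le> arccos (p \<bullet> q)" and "arccos (p \<bullet> q) \<le> pi"
proof -
  have pq: "\<bar>p \<bullet> q\<bar> \<le> 1"
    using Cauchy_Schwarz_ineq2[of p q] assms by simp
  then show ge: "0 \<le> arccos (p \<bullet> q)" and le: "arccos (p \<bullet> q) \<le> pi"
    using arccos_bounded by (auto simp: abs_le_iff)
  have "(norm (q - p))\<^sup>2 = 2 - 2 * (p \<bullet> q)"
    using assms by (simp add: power2_norm_eq_inner inner_diff inner_commute norm_eq_1)
  also have "p \<bullet> q = cos (2 * (arccos (p \<bullet> q) / 2))"
    using pq by (simp add: abs_le_iff)
  also have "2 - 2 * \<dots> = (2 * sin (arccos (p \<bullet> q) / 2))\<^sup>2"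
    by (subst cos_double_sin) (simp add: power2_eq_square)
  finally show "norm (q - p) = 2 * sin (arccos (p \<bullet> q) / 2)"
    using ge le by (subst (asm) power2_eq_iff_nonneg) (auto intro!: sin_ge_zero)
qed

lemma chord_le_angle:
  fixes p q :: "'a::real_inner"
  assumes "norm p = 1" "norm q = 1"
  shows "norm (q - p) \<le> arccos (p \<bullet> q)"
  using chord_eq_sin_half_angle[OF assms] sin_x_le_x[of "arccos (p \<bullet> q) / 2"] by simp

text \<open>The error is cubic in the chord: over M steps of size O(1/M) the errors add up to
  O(1/M^2), so angle sums and chord sums have the same limit. The factor 2 is generous; the argument
  gives 9/8.\<close>

lemma angle_le_chord:
  fixes p q :: "'a::real_inner"
  assumes "norm p = 1" "norm q = 1"
  shows "arccos (p \<bullet> q) \<le> norm (q - p) + 2 * norm (q - p) ^ 3"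
proof -
  define x where "x = arccos (p \<bullet> q) / 2"
  define d where "d = norm (q - p)"
  have d: "d = 2 * sin x" and x: "0 \<le> x" "x \<le> 2"
    using chord_eq_sin_half_angle[OF assms] pi_half_less_two by (auto simp: x_def d_def)
  have cub: "x - x^3 / 6 \<le> sin x"
    using sin_ge_cubic x by simp
  \<comment> \<open>A half angle is at most pi/2 < 2, hence x - x^3/6 \<ge> x/3 and the chord is at
    least a third of the angle.\<close>
  have "x ^ 3 \<le> x * 4"
    using x mult_left_mono[of "x * x" "2 * 2" x] mult_mono[of x 2 x 2]
    by (simp add: power3_eq_cube mult.assoc)
  then have "2 * x \<le> 3 * d"
    using cub d by simp
  then have "(2 * x) ^ 3 \<le> (3 * d) ^ 3"
    using x by (intro power_mono) auto
  then have "x ^ 3 \<le> 27 / 8 * d ^ 3"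
    by (simp add: power_mult_distrib)
  moreover have "0 \<le> d ^ 3"
    by (simp add: d_def)
  ultimately have "2 * x \<le> d + 2 * d ^ 3"
    using cub d by linarith
  then show ?thesis
    by (simp add: x_def d_def)
qed

section \<open>Uniform grids, and length as a limit of inscribed polygons\<close>

definition grid :: "real \<Rightarrow> real \<Rightarrow> nat \<Rightarrow> nat \<Rightarrow> real"
  where "grid a b M k = a + (b - a) * real k / real M"

lemma grid_0 [simp]: "grid a b M 0 = a"
  by (simp add: grid_def)

lemma grid_last [simp]: "M > 0 \<Longrightarrow> grid a b M M = b"
  by (simp add: grid_def)

lemma grid_Suc: "grid a b M (Suc k) = grid a b M k + (b - a) / real M"
  by (simp add: grid_def add_divide_distrib distrib_left)

lemma grid_mono: "a \<le> b \<Longrightarrow> j \<le> k \<Longrightarrow> grid a b M j \<le> grid a b M k"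
  by (auto simp: grid_def intro!: divide_right_mono mult_left_mono)

lemma grid_strict_mono: "a < b \<Longrightarrow> M > 0 \<Longrightarrow> j < k \<Longrightarrow> grid a b M j < grid a b M k"
  by (auto simp: grid_def intro!: divide_strict_right_mono mult_strict_left_mono)

lemma grid_bounds: "a \<le> b \<Longrightarrow> k \<le> M \<Longrightarrow> M > 0 \<Longrightarrow> grid a b M k \<in> {a..b}"
  using grid_mono[of a b 0 k M] grid_mono[of a b k M M] by auto

lemma integral_eq_sum_grid:
  fixes g :: "real \<Rightarrow> 'a::banach"
  assumes "a \<le> b" "M > 0" "g integrable_on {a..b}"
  shows "integral {a..b} g = (\<Sum>k<M. integral {grid a b M k..grid a b M (Suc k)} g)"
proof -
  have "integral {a..grid a b M m} g = (\<Sum>k<m. integral {grid a b M k..grid a b M (Suc k)} g)"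
    if "m \<le> M" for m
    using that
  proof (induction m)
    case 0
    then show ?case by simp
  next
    case (Suc m)
    have "g integrable_on {a..grid a b M (Suc m)}"
      using Suc.prems assms grid_bounds[of a b "Suc m" M]
      by (intro integrable_subinterval_real[OF assms(3)]) auto
    then have "integral {a..grid a b M m} g + integral {grid a b M m..grid a b M (Suc m)} g
        = integral {a..grid a b M (Suc m)} g"
      using assms Suc.prems grid_bounds[of a b m M]
      by (intro Henstock_Kurzweil_Integration.integral_combine) (auto intro: grid_mono)
    then show ?case
      using Suc by simp
  qed
  from this[of M] show ?thesis
    using assms by simp
qed

context
  fixes f f' :: "real \<Rightarrow> 'a::euclidean_space" and a b :: real
  assumes ab: "a < b"
    and der: "\<And>s. s \<in> {a..b} \<Longrightarrow> (f has_vector_derivative f' s) (at s within {a..b})"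
    and cont: "continuous_on {a..b} f'"
begin

lemma speed_integrable: "{s..r} \<subseteq> {a..b} \<Longrightarrow> (\<lambda>u. norm (f' u)) integrable_on {s..r}"
  by (intro integrable_continuous_real continuous_intros continuous_on_subset[OF cont])

lemma has_integral_derivative:
  assumes "s \<le> r" "{s..r} \<subseteq> {a..b}"
  shows "(f' has_integral (f r - f s)) {s..r}"
  using assms der
  by (intro fundamental_theorem_of_calculus) (auto intro!: has_vector_derivative_within_subset[OF der])

lemma chord_le_length:
  assumes "s \<le> r" "{s..r} \<subseteq> {a..b}"
  shows "norm (f r - f s) \<le> integral {s..r} (\<lambda>u. norm (f' u))"
proof -
  have "norm (integral {s..r} f') \<le> integral {s..r} (\<lambda>u. norm (f' u))"
    using has_integral_derivative[OF assms] speed_integrable[OF assms(2)]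
    by (intro integral_norm_bound_integral) auto
  then show ?thesis
    using integral_unique[OF has_integral_derivative[OF assms]] by simp
qed

text \<open>With the velocity within \<open>e\<close> of \<open>f' s\<close>, both the chord and the
  length differ from \<open>norm (f' s) * (r - s)\<close> by at most \<open>e * (r - s)\<close>;
  this is the source of the factor 2.\<close>

lemma length_le_chord:
  assumes sr: "s \<le> r" "{s..r} \<subseteq> {a..b}"
    and e: "\<And>u. u \<in> {s..r} \<Longrightarrow> norm (f' u - f' s) \<le> e"
  shows "integral {s..r} (\<lambda>u. norm (f' u)) \<le> norm (f r - f s) + 2 * e * (r - s)"
proof -
  have "0 \<le> e"
    using e[of s] sr norm_ge_zero[of "f' s - f' s"] by (auto intro: order_trans)
  have "((\<lambda>u. f' u - f' s) has_integral ((f r - f s) - (r - s) *\<^sub>R f' s)) {s..r}"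
    using has_integral_diff[OF has_integral_derivative[OF sr] has_integral_const_real[of "f' s" s r]] sr
    by simp
  then have "norm ((f r - f s) - (r - s) *\<^sub>R f' s) \<le> e * (r - s)"
    using e sr \<open>0 \<le> e\<close> has_integral_bound_real[of e "{}" "\<lambda>u. f' u - f' s" _ s r]
    by auto
  moreover have "norm ((r - s) *\<^sub>R f' s) \<le> norm (f r - f s) + norm ((f r - f s) - (r - s) *\<^sub>R f' s)"
    by (metis norm_minus_commute norm_triangle_sub)
  moreover have "integral {s..r} (\<lambda>u. norm (f' u)) \<le> integral {s..r} (\<lambda>u. norm (f' s) + e)"
  proof (intro integral_le speed_integrable[OF sr(2)])
    fix u assume "u \<in> {s..r}"
    then show "norm (f' u) \<le> norm (f' s) + e"
      using e[of u] norm_triangle_sub[of "f' u" "f' s"] by simp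
  qed auto
  moreover have "norm ((r - s) *\<^sub>R f' s) = norm (f' s) * (r - s)"
    using sr by simp
  moreover have "integral {s..r} (\<lambda>u. norm (f' s) + e) = norm (f' s) * (r - s) + e * (r - s)"
    using sr by (simp add: algebra_simps)
  ultimately show ?thesis
    by linarith
qed

lemma chord_sum_tendsto_length:
  "(\<lambda>M. \<Sum>k<M. norm (f (grid a b M (Suc k)) - f (grid a b M k)))
    \<longlonglongrightarrow> integral {a..b} (\<lambda>u. norm (f' u))" (is "?S \<longlonglongrightarrow> ?L")
proof (rule LIMSEQ_I)
  fix r :: real assume "r > 0"
  \<comment> \<open>The total defect is \<open>2 * e * (b - a)\<close>, which this choice makes
    equal to \<open>r / 2\<close>.\<close>
  define e where "e = r / (4 * (b - a))"
  have "e > 0"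
    using ab \<open>r > 0\<close> by (simp add: e_def)
  have "uniformly_continuous_on {a..b} f'"
    using cont by (simp add: compact_uniformly_continuous)
  then obtain d where d: "d > 0"
    "\<And>u v. u \<in> {a..b} \<Longrightarrow> v \<in> {a..b} \<Longrightarrow> dist u v < d \<Longrightarrow> dist (f' u) (f' v) < e"
    using \<open>e > 0\<close> unfolding uniformly_continuous_on_def by metis
  obtain N :: nat where N: "(b - a) / d < N"
    using reals_Archimedean2 by blast
  show "\<exists>no. \<forall>M\<ge>no. norm (?S M - ?L) < r"
  proof (intro exI[of _ "Suc N"] allI impI)
    fix M assume M: "M \<ge> Suc N"
    then have M0: "M > 0" by simp
    have "(b - a) / d < M"
      using N M by linarith
    then have step: "(b - a) / M < d"
      using d(1) M0 by (simp add: field_simps)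
    have L: "?L = (\<Sum>k<M. integral {grid a b M k..grid a b M (Suc k)} (\<lambda>u. norm (f' u)))"
      using ab M0 speed_integrable[of a b] by (intro integral_eq_sum_grid) auto
    have piece: "{grid a b M k..grid a b M (Suc k)} \<subseteq> {a..b}"
        "grid a b M k \<le> grid a b M (Suc k)" if "k < M" for k
      using that grid_bounds[of a b k M] grid_bounds[of a b "Suc k" M] ab
      by (auto intro: grid_mono)
    have "?S M \<le> ?L"
      unfolding L by (intro sum_mono chord_le_length piece) auto
    moreover have "?L \<le> (\<Sum>k<M. norm (f (grid a b M (Suc k)) - f (grid a b M k)) + 2 * e * ((b - a) / M))"
      unfolding L
    proof (intro sum_mono)
      fix k assume "k \<in> {..<M}"
      then have k: "k < M" by simp
      have "integral {grid a b M k..grid a b M (Suc k)} (\<lambda>u. norm (f' u))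
         \<le> norm (f (grid a b M (Suc k)) - f (grid a b M k)) + 2 * e * (grid a b M (Suc k) - grid a b M k)"
      proof (intro length_le_chord piece[OF k])
        fix u assume u: "u \<in> {grid a b M k..grid a b M (Suc k)}"
        then have "dist u (grid a b M k) < d"
          using step grid_Suc[of a b M k] by (simp add: dist_real_def)
        then show "norm (f' u - f' (grid a b M k)) \<le> e"
          using d(2)[of u "grid a b M k"] u piece[OF k] by (force simp: dist_norm)
      qed
      then show "integral {grid a b M k..grid a b M (Suc k)} (\<lambda>u. norm (f' u))
         \<le> norm (f (grid a b M (Suc k)) - f (grid a b M k)) + 2 * e * ((b - a) / M)"
        by (simp add: grid_Suc)
    qed
    moreover have "\<dots> = ?S M + 2 * e * (b - a)"
      using M0 by (simp add: sum.distrib)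
    moreover have "2 * e * (b - a) < r"
      using ab \<open>r > 0\<close> by (simp add: e_def field_simps)
    ultimately show "norm (?S M - ?L) < r"
      by simp
  qed
qed

text \<open>Each angle exceeds its chord by at most twice the cube of the chord, and a chord is at
  most \<open>B * (b - a) / M\<close> for a bound \<open>B\<close> on the speed. The M errors sum to
  \<open>2 * K / M^2\<close>, and squeezing between chord sums gives the limit.\<close>

lemma angle_sum_tendsto_length:
  assumes unit: "\<And>s. s \<in> {a..b} \<Longrightarrow> norm (f s) = 1"
  shows "(\<lambda>M. \<Sum>k<M. arccos (f (grid a b M k) \<bullet> f (grid a b M (Suc k))))
    \<longlonglongrightarrow> integral {a..b} (\<lambda>u. norm (f' u))" (is "?A \<longlonglongrightarrow> ?L")
proof -
  let ?S = "\<lambda>M. \<Sum>k<M. norm (f (grid a b M (Suc k)) - f (grid a b M k))"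
  obtain B where B: "\<And>u. u \<in> {a..b} \<Longrightarrow> norm (f' u) \<le> B"
    using compact_imp_bounded[OF compact_continuous_image[OF cont compact_Icc]]
    unfolding bounded_iff by blast
  define K where "K = (B * (b - a)) ^ 3"
  have node: "grid a b M k \<in> {a..b}" "grid a b M (Suc k) \<in> {a..b}" if "k < M" for M k
    using that grid_bounds[of a b _ M] ab by (auto simp del: atLeastAtMost_iff)
  have chord: "norm (f (grid a b M (Suc k)) - f (grid a b M k)) \<le> B * ((b - a) / M)" if k: "k < M" for M k
  proof -
    have "grid a b M k \<le> grid a b M (Suc k)"
      using ab by (auto intro: grid_mono)
    with node[OF k] have "norm (f (grid a b M (Suc k)) - f (grid a b M k))
        \<le> integral {grid a b M k..grid a b M (Suc k)} (\<lambda>u. norm (f' u))"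
      by (intro chord_le_length) auto
    also have "\<dots> \<le> integral {grid a b M k..grid a b M (Suc k)} (\<lambda>u. B)"
      using node[OF k] B by (intro integral_le speed_integrable) auto
    also have "\<dots> = B * ((b - a) / M)"
      using \<open>grid a b M k \<le> _\<close> by (simp add: grid_Suc ab less_imp_le mult.commute)
    finally show ?thesis .
  qed
  have lower: "\<forall>\<^sub>F M in sequentially. ?S M \<le> ?A M"
    using node unit by (intro always_eventually allI sum_mono chord_le_angle) auto
  have upper: "\<forall>\<^sub>F M in sequentially. ?A M \<le> ?S M + 2 * K / real M ^ 2"
  proof (intro eventually_sequentiallyI[of 1])
    fix M :: nat assume "1 \<le> M"
    have "?A M \<le> (\<Sum>k<M. norm (f (grid a b M (Suc k)) - f (grid a b M k)) + 2 * (K / real M ^ 3))"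
    proof (intro sum_mono)
      fix k assume "k \<in> {..<M}"
      then have k: "k < M" by simp
      have "norm (f (grid a b M (Suc k)) - f (grid a b M k)) ^ 3 \<le> (B * ((b - a) / M)) ^ 3"
        using chord[OF k] by (intro power_mono) auto
      also have "\<dots> = K / real M ^ 3"
        by (simp add: K_def power_divide power_mult_distrib)
      finally show "arccos (f (grid a b M k) \<bullet> f (grid a b M (Suc k)))
          \<le> norm (f (grid a b M (Suc k)) - f (grid a b M k)) + 2 * (K / real M ^ 3)"
        using angle_le_chord[of "f (grid a b M k)" "f (grid a b M (Suc k))"] unit node[OF k] by simp
    qed
    also have "\<dots> = ?S M + 2 * K / real M ^ 2"
      using \<open>1 \<le> M\<close> by (simp add: sum.distrib power2_eq_square power3_eq_cube)
    finally show "?A M \<le> ?S M + 2 * K / real M ^ 2" .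
  qed
  have "(\<lambda>M. 2 * K / real M ^ 2) \<longlonglongrightarrow> 0"
    by real_asymp
  from tendsto_add[OF chord_sum_tendsto_length this]
  have "(\<lambda>M. ?S M + 2 * K / real M ^ 2) \<longlonglongrightarrow> ?L"
    by simp
  from tendsto_sandwich[OF lower upper chord_sum_tendsto_length this] show ?thesis .
qed

end

section \<open>Volumes of lunes\<close>

text \<open>Cauchy's functional equation on an interval. Nonnegativity turns additivity into
  monotonicity, so \<open>h x\<close> is caught between the values at neighbouring multiples of
  \<open>P / N\<close>, where additivity alone determines \<open>h\<close>.\<close>

lemma additive_nonneg_imp_linear:
  fixes h :: "real \<Rightarrow> real"
  assumes add: "\<And>x y. 0 \<le> x \<Longrightarrow> 0 \<le> y \<Longrightarrow> x + y \<le> P \<Longrightarrow> h (x + y) = h x + h y"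
    and nonneg: "\<And>x. 0 \<le> x \<Longrightarrow> x \<le> P \<Longrightarrow> 0 \<le> h x"
    and "P > 0" and x: "0 \<le> x" "x \<le> P"
  shows "h x = x / P * h P"
proof (cases "x = P")
  case True
  then show ?thesis using \<open>P > 0\<close> by simp
next
  case False
  with x have "x < P" by simp
  have mono: "h u \<le> h v" if "0 \<le> u" "u \<le> v" "v \<le> P" for u v
    using add[of u "v - u"] nonneg[of "v - u"] that by simp
  have h0: "h 0 = 0"
    using add[of 0 0] \<open>P > 0\<close> by simp
  have mult: "h (real k * u) = real k * h u" if "0 \<le> u" "real k * u \<le> P" for k u
    using that
  proof (induction k)
    case (Suc k)
    then have "real k * u \<le> P"
      by (simp add: algebra_simps)
    with Suc show ?case
      using add[of "real k * u" u] by (simp add: algebra_simps)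
  qed (simp add: h0)
  have frac: "h (real k * P / real N) = real k / real N * h P" if "N > 0" "k \<le> N" for k N
  proof -
    have le: "real k * P / real N \<le> P"
      using that \<open>P > 0\<close> by (simp add: field_simps)
    have "h P = real N * h (P / real N)"
      using mult[of "P / real N" N] that \<open>P > 0\<close> by simp
    moreover have "h (real k * (P / real N)) = real k * h (P / real N)"
      using le \<open>P > 0\<close> by (intro mult) auto
    ultimately show ?thesis
      using that by simp
  qed
  have bound: "\<bar>h x - x / P * h P\<bar> \<le> h P / real N" if N: "N > 0" for N
  proof -
    \<comment> \<open>The multiple of \<open>P / N\<close> just below \<open>x\<close>;
      \<open>x < P\<close> keeps the next one inside the interval.\<close>
    define k where "k = nat \<lfloor>real N * x / P\<rfloor>"
    have k: "real k \<le> real N * x / P" "real N * x / P < real k + 1"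
      using x \<open>P > 0\<close> by (auto simp: k_def)
    have "real N * x / P < real N"
      using \<open>x < P\<close> \<open>P > 0\<close> N by (simp add: field_simps)
    then have kN: "k < N"
      using k by linarith
    have "h (real k * P / real N) \<le> h x"
      using k N x \<open>P > 0\<close> by (intro mono) (auto simp: field_simps)
    moreover have "h x \<le> h (real (Suc k) * P / real N)"
      using k kN N x \<open>P > 0\<close>
      by (intro mono) (auto simp: field_simps less_imp_le simp flip: of_nat_Suc)
    ultimately have 1: "real k / real N * h P \<le> h x" "h x \<le> (real k + 1) / real N * h P"
      using frac[of N k] frac[of N "Suc k"] kN N by (auto simp: add.commute)
    have 2: "real k / real N \<le> x / P" "x / P \<le> (real k + 1) / real N"
      using k N \<open>P > 0\<close> by (auto simp: field_simps)
    have "0 \<le> h P"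
      using nonneg[of P] \<open>P > 0\<close> by simp
    then have "real k / real N * h P \<le> x / P * h P" "x / P * h P \<le> (real k + 1) / real N * h P"
      using 2 by (auto intro: mult_right_mono simp del: times_divide_eq_left)
    with 1 show ?thesis
      by (simp add: add_divide_distrib distrib_right abs_le_iff)
  qed
  have "(\<lambda>N. h P / real N) \<longlonglongrightarrow> 0"
    by real_asymp
  moreover have "\<forall>\<^sub>F N in sequentially. \<bar>h x - x / P * h P\<bar> \<le> h P / real N"
    using bound by (intro eventually_sequentiallyI[of 1]) auto
  ultimately have "\<bar>h x - x / P * h P\<bar> \<le> 0"
    by (intro tendsto_lowerbound) auto
  then show ?thesis by simp
qed

text \<open>The normals of the planes through 0 that separate \<open>p\<close> from
  \<open>q\<close>. The closed form also counts planes through \<open>p\<close> or \<open>q\<close>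
  and suits lower bounds on crossings; \<open>open_lune\<close> omits them and suits upper bounds.
  For nonzero \<open>p\<close> and \<open>q\<close> the two differ by a null set.\<close>

definition lune :: "real^3 \<Rightarrow> real^3 \<Rightarrow> (real^3) set"
  where "lune p q = {n \<in> ball 0 1. (n \<bullet> p) * (n \<bullet> q) \<le> 0}"

definition open_lune :: "real^3 \<Rightarrow> real^3 \<Rightarrow> (real^3) set"
  where "open_lune p q = {n \<in> ball 0 1. (n \<bullet> p) * (n \<bullet> q) < 0}"

lemma lmeasurable_ball_Collect:
  fixes P :: "real^3 \<Rightarrow> bool"
  assumes "{n. P n} \<in> sets borel"
  shows "{n \<in> ball 0 1. P n} \<in> lmeasurable"
proof -
  have "{n \<in> ball 0 1. P n} = ball 0 1 \<inter> {n. P n}"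
    by auto
  also have "\<dots> \<in> sets borel"
    using assms by (intro sets.Int) auto
  finally show ?thesis
    by (intro bounded_set_imp_lmeasurable) (auto intro: bounded_subset[of "ball 0 1"])
qed

lemma lmeasurable_lune [simp]: "lune p q \<in> lmeasurable"
  unfolding lune_def
  by (intro lmeasurable_ball_Collect borel_closed closed_Collect_le continuous_intros)

lemma lmeasurable_open_lune [simp]: "open_lune p q \<in> lmeasurable"
  unfolding open_lune_def
  by (intro lmeasurable_ball_Collect borel_open open_Collect_less continuous_intros)

lemma AE_inner_nonzero: "AE n in lebesgue. n \<bullet> p \<noteq> 0" if "p \<noteq> 0" for p :: "real^3"
proof (rule AE_I')
  show "{n. p \<bullet> n = 0} \<in> null_sets lebesgue"
    using negligible_hyperplane[of p 0] that by (simp add: negligible_iff_null_sets)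
qed (auto simp: inner_commute)

lemma measure_open_lune:
  assumes "p \<noteq> 0" "q \<noteq> 0"
  shows "measure lebesgue (open_lune p q) = measure lebesgue (lune p q)"
proof (rule measure_eq_AE)
  show "AE n in lebesgue. (n \<in> open_lune p q) = (n \<in> lune p q)"
    using AE_inner_nonzero[OF assms(1)] AE_inner_nonzero[OF assms(2)]
    by eventually_elim (auto simp: open_lune_def lune_def order_less_le)
qed (auto simp: fmeasurableD)

lemma orthogonal_transformation_lune:
  assumes "orthogonal_transformation T"
  shows "measure lebesgue (lune (T p) (T q)) = measure lebesgue (lune p q)"
proof -
  have inner: "T v \<bullet> T w = v \<bullet> w" and norm: "norm (T v) = norm v" for v w
    using assms by (auto simp: orthogonal_transformation_def orthogonal_transformation_norm)
  have "T ` lune p q = lune (T p) (T q)"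
  proof (intro equalityI subsetI)
    fix n assume n: "n \<in> lune (T p) (T q)"
    obtain m where "n = T m"
      using orthogonal_transformation_surj[OF assms] by blast
    with n show "n \<in> T ` lune p q"
      by (auto simp: lune_def inner norm)
  qed (auto simp: lune_def inner norm)
  then show ?thesis
    using measure_orthogonal_image[OF assms, of "lune p q"] by simp
qed

text \<open>The cross product completes \<open>u\<close>, \<open>v\<close> to an orthonormal basis,
  and sending the standard basis to it is orthogonal. Every lune can thus be rotated into a standard
  position.\<close>

lemma orthogonal_transformation_frame:
  fixes u v :: "real^3"
  assumes "norm u = 1" "norm v = 1" "u \<bullet> v = 0"
  obtains T :: "real^3 \<Rightarrow> real^3"
  where "orthogonal_transformation T" "T (axis 1 1) = u" "T (axis 2 1) = v"
proof
  define w where "w = cross3 u v"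
  have uvw: "u \<bullet> u = 1" "v \<bullet> v = 1" "w \<bullet> w = 1" "u \<bullet> v = 0" "v \<bullet> u = 0"
      "u \<bullet> w = 0" "w \<bullet> u = 0" "v \<bullet> w = 0" "w \<bullet> v = 0"
    using assms by (simp_all add: w_def dot_cross dot_cross_self norm_eq_1 inner_commute)
  define T where "T = (\<lambda>x::real^3. (x $ 1) *\<^sub>R u + (x $ 2) *\<^sub>R v + (x $ 3) *\<^sub>R w)"
  have "linear T"
    by (rule linearI) (auto simp: T_def algebra_simps)
  moreover have "T x \<bullet> T y = x $ 1 * y $ 1 + x $ 2 * y $ 2 + x $ 3 * y $ 3" for x y
    by (simp add: T_def inner_add_left inner_add_right uvw)
  ultimately show "orthogonal_transformation T"
    by (simp add: orthogonal_transformation_def inner_vec_def sum_3)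
  show "T (axis 1 1) = u" "T (axis 2 1) = v"
    by (simp_all add: T_def axis_def)
qed

text \<open>For orthonormal \<open>u\<close>, \<open>v\<close> this is the great circle from
  \<open>u\<close> through \<open>v\<close>, parametrised by arc length.\<close>

definition meridian :: "real^3 \<Rightarrow> real^3 \<Rightarrow> real \<Rightarrow> real^3"
  where "meridian u v \<theta> = cos \<theta> *\<^sub>R u + sin \<theta> *\<^sub>R v"

lemma inner_meridian: "n \<bullet> meridian u v \<theta> = cos \<theta> * (n \<bullet> u) + sin \<theta> * (n \<bullet> v)"
  by (simp add: meridian_def inner_add_right)

abbreviation lune_angle :: "real \<Rightarrow> real"
  where "lune_angle \<theta> \<equiv> measure lebesgue (lune (axis 1 1) (meridian (axis 1 1) (axis 2 1) \<theta>))"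

lemma measure_lune_meridian:
  assumes "norm u = 1" "norm v = 1" "u \<bullet> v = 0"
  shows "measure lebesgue (lune u (meridian u v \<theta>)) = lune_angle \<theta>"
proof -
  obtain T :: "real^3 \<Rightarrow> real^3" where T: "orthogonal_transformation T" "T (axis 1 1) = u" "T (axis 2 1) = v"
    using orthogonal_transformation_frame[OF assms] .
  interpret T: linear T
    using T(1) by (rule orthogonal_transformation_linear)
  have "T (meridian (axis 1 1) (axis 2 1) \<theta>) = meridian u v \<theta>"
    by (simp add: meridian_def T.add T.scale T)
  then show ?thesis
    using orthogonal_transformation_lune[OF T(1)] T(2) by metis
qed

lemma meridian_frame:
  assumes "norm u = 1" "norm v = 1" "u \<bullet> v = 0"
  shows "norm (meridian u v \<alpha>) = 1"
    and "meridian u v (\<alpha> + \<beta>) =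
      meridian (meridian u v \<alpha>) (meridian u v (\<alpha> + pi / 2)) \<beta>"
    and "meridian u v \<alpha> \<bullet> meridian u v (\<alpha> + pi / 2) = 0"
proof -
  have uv: "u \<bullet> u = 1" "v \<bullet> v = 1" "u \<bullet> v = 0" "v \<bullet> u = 0"
    using assms by (auto simp: norm_eq_1 inner_commute)
  show "norm (meridian u v \<alpha>) = 1"
    unfolding norm_eq_1 by (simp add: meridian_def algebra_simps inner_simps uv flip: power2_eq_square)
  show "meridian u v (\<alpha> + \<beta>) =
      meridian (meridian u v \<alpha>) (meridian u v (\<alpha> + pi / 2)) \<beta>"
    by (simp add: meridian_def cos_add sin_add algebra_simps)
  show "meridian u v \<alpha> \<bullet> meridian u v (\<alpha> + pi / 2) = 0"
    by (simp add: meridian_def cos_add sin_add inner_simps uv)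
qed

text \<open>The point at angle \<alpha> lies on the arc from angle 0 to \<alpha> + \<beta>. Off a
  null set, a plane that separates the ends separates this point from exactly one of them, and any
  other plane has all three points on one side; so the large lune splits into the two small
  ones.\<close>

lemma lune_angle_add:
  assumes "0 \<le> \<alpha>" "0 \<le> \<beta>" "\<alpha> + \<beta> \<le> pi"
  shows "lune_angle (\<alpha> + \<beta>) = lune_angle \<alpha> + lune_angle \<beta>"
proof -
  let ?u = "axis 1 1 :: real^3" and ?v = "axis 2 1 :: real^3"
  have uv: "norm ?u = 1" "norm ?v = 1" "?u \<bullet> ?v = 0"
    by (auto simp: inner_axis_axis)
  define e where "e = meridian ?u ?v"
  have e0: "e 0 = ?u"
    by (simp add: e_def meridian_def)
  have AE: "AE n in lebesgue. n \<bullet> e \<theta> \<noteq> 0" for \<theta>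
    using meridian_frame(1)[OF uv, of \<theta>] by (intro AE_inner_nonzero) (auto simp: e_def)
  have zero: "lune_angle 0 = 0"
  proof -
    have "measure lebesgue (lune (e 0) (e 0)) = measure lebesgue ({} :: (real^3) set)"
    proof (rule measure_eq_AE)
      show "AE n in lebesgue. (n \<in> lune (e 0) (e 0)) = (n \<in> {})"
        using AE[of 0] by eventually_elim (auto simp: lune_def mult_le_0_iff)
    qed (auto simp: fmeasurableD)
    then show ?thesis
      by (simp add: e_def meridian_def)
  qed
  show ?thesis
  proof (cases "\<alpha> = 0 \<or> \<beta> = 0")
    case True
    then show ?thesis using zero by auto
  next
    case False
    with assms have ab: "0 < \<alpha>" "0 < \<beta>" "\<alpha> < pi" "\<beta> < pi"
      by auto
    have shift: "measure lebesgue (lune (e \<alpha>) (e (\<alpha> + \<beta>))) = lune_angle \<beta>"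
      unfolding e_def meridian_frame(2)[OF uv, of \<alpha> \<beta>]
      by (intro measure_lune_meridian meridian_frame uv)
    \<comment> \<open>Pairing of \<open>n\<close> with sin(\<alpha> + \<beta>) e(\<alpha>) = sin
      \<beta> e(0) + sin \<alpha> e(\<alpha> + \<beta>), which puts the middle point in the cone
      spanned by the ends if \<alpha> + \<beta> < pi. At \<alpha> + \<beta> = pi the ends are
      antipodal and \<open>between\<close> holds vacuously.\<close>
    have rel: "(n \<bullet> e \<alpha>) * sin (\<alpha> + \<beta>) = (n \<bullet> e 0) * sin \<beta> + (n \<bullet> e (\<alpha> + \<beta>)) * sin \<alpha>" for n
    proof -
      have "(cos \<alpha> * x + sin \<alpha> * y) * (sin \<alpha> * cos \<beta> + cos \<alpha> * sin \<beta>) = x * sin \<beta>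
          + ((cos \<alpha> * cos \<beta> - sin \<alpha> * sin \<beta>) * x + (sin \<alpha> * cos \<beta> + cos \<alpha> * sin \<beta>) * y) * sin \<alpha>" for x y
        using sin_cos_squared_add[of \<alpha>] by algebra
      then show ?thesis
        by (simp add: e_def inner_meridian cos_add sin_add)
    qed
    have s: "0 < sin \<alpha>" "0 < sin \<beta>" "0 \<le> sin (\<alpha> + \<beta>)"
      using ab assms by (auto intro: sin_gt_zero sin_ge_zero)
    have between:
      "(n \<bullet> e 0 > 0 \<longrightarrow> n \<bullet> e (\<alpha> + \<beta>) > 0 \<longrightarrow> n \<bullet> e \<alpha> > 0) \<and>
       (n \<bullet> e 0 < 0 \<longrightarrow> n \<bullet> e (\<alpha> + \<beta>) < 0 \<longrightarrow> n \<bullet> e \<alpha> < 0)" for n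
    proof (intro conjI impI)
      show "n \<bullet> e \<alpha> > 0" if "n \<bullet> e 0 > 0" "n \<bullet> e (\<alpha> + \<beta>) > 0"
      proof -
        have "0 < (n \<bullet> e \<alpha>) * sin (\<alpha> + \<beta>)"
          unfolding rel using that s by (intro add_pos_pos mult_pos_pos)
        then show ?thesis
          using s by (simp add: zero_less_mult_iff)
      qed
      show "n \<bullet> e \<alpha> < 0" if "n \<bullet> e 0 < 0" "n \<bullet> e (\<alpha> + \<beta>) < 0"
      proof -
        have "(n \<bullet> e \<alpha>) * sin (\<alpha> + \<beta>) < 0"
          unfolding rel using that s by (intro add_neg_neg mult_neg_pos)
        then show ?thesis
          using s by (simp add: mult_less_0_iff)
      qed
    qed
    have "measure lebesgue (lune (e 0) (e (\<alpha> + \<beta>)))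
        = measure lebesgue (lune (e 0) (e \<alpha>) \<union> lune (e \<alpha>) (e (\<alpha> + \<beta>)))"
    proof (rule measure_eq_AE)
      show "AE n in lebesgue. (n \<in> lune (e 0) (e (\<alpha> + \<beta>)))
          = (n \<in> lune (e 0) (e \<alpha>) \<union> lune (e \<alpha>) (e (\<alpha> + \<beta>)))"
        using AE[of 0] AE[of \<alpha>] AE[of "\<alpha> + \<beta>"]
      proof eventually_elim
        case (elim n)
        then show ?case
          using between[of n] by (auto simp: lune_def mult_le_0_iff)
      qed
    qed (auto simp: fmeasurableD)
    also have "\<dots> = measure lebesgue (lune (e 0) (e \<alpha>)) + measure lebesgue (lune (e \<alpha>) (e (\<alpha> + \<beta>)))"
    proof (rule measure_Un_AE)
      show "AE n in lebesgue. n \<notin> lune (e 0) (e \<alpha>) \<or> n \<notin> lune (e \<alpha>) (e (\<alpha> + \<beta>))"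
        using AE[of 0] AE[of \<alpha>] AE[of "\<alpha> + \<beta>"]
      proof eventually_elim
        case (elim n)
        then show ?case
          using between[of n] by (auto simp: lune_def mult_le_0_iff)
      qed
    qed auto
    finally show ?thesis
      using shift by (simp add: e0) (simp add: e_def)
  qed
qed

text \<open>Volume of a lune per unit of angle: antipodal points are at angle pi, and their closed
  lune is the whole ball.\<close>

definition lune_const :: real
  where "lune_const = measure lebesgue (ball 0 1 :: (real^3) set) / pi"

lemma lune_const_pos: "lune_const > 0"
  by (simp add: lune_const_def content_ball_pos)

lemma lune_angle_eq:
  assumes "0 \<le> \<theta>" "\<theta> \<le> pi"
  shows "lune_angle \<theta> = lune_const * \<theta>"
proof -
  have "lune (axis 1 1) (meridian (axis 1 1) (axis 2 1) pi) = ball 0 1"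
    by (auto simp: lune_def inner_meridian)
  moreover have "lune_angle \<theta> = \<theta> / pi * lune_angle pi"
    by (rule additive_nonneg_imp_linear) (use assms lune_angle_add in auto)
  ultimately show ?thesis
    by (simp add: lune_const_def)
qed

lemma measure_lune:
  assumes p: "norm p = 1" and q: "norm q = 1"
  shows "measure lebesgue (lune p q) = lune_const * arccos (p \<bullet> q)"
proof -
  define \<theta> where "\<theta> = arccos (p \<bullet> q)"
  have "\<bar>p \<bullet> q\<bar> \<le> 1"
    using Cauchy_Schwarz_ineq2[of p q] assms by simp
  then have \<theta>: "0 \<le> \<theta>" "\<theta> \<le> pi" "cos \<theta> = p \<bullet> q"
    using arccos_bounded by (auto simp: \<theta>_def abs_le_iff)
  have pq: "p \<bullet> p = 1" "q \<bullet> q = 1" "q \<bullet> p = p \<bullet> q"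
    using p q by (auto simp: norm_eq_1 inner_commute)
  define r where "r = q - cos \<theta> *\<^sub>R p"
  have r: "p \<bullet> r = 0" "norm r = sin \<theta>"
  proof -
    show "p \<bullet> r = 0"
      by (simp add: r_def inner_diff_right pq \<theta>)
    have "(norm r)\<^sup>2 = 1 - (cos \<theta>)\<^sup>2"
      unfolding power2_norm_eq_inner by (simp add: r_def inner_diff pq \<theta> power2_eq_square)
    also have "\<dots> = (sin \<theta>)\<^sup>2"
      by (simp add: sin_squared_eq)
    finally show "norm r = sin \<theta>"
      using \<theta> by (simp add: power2_eq_iff_nonneg sin_ge_zero)
  qed
  obtain v where v: "norm v = 1" "p \<bullet> v = 0" "q = meridian p v \<theta>"
  proof (cases "sin \<theta> = 0")
    case True
    \<comment> \<open>Here \<open>q\<close> is \<open>p\<close> or \<open>- p\<close>, which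
      determines no plane; any unit vector orthogonal to \<open>p\<close> can serve as
      \<open>v\<close>.\<close>
    obtain y where "y \<noteq> 0" "orthogonal p y"
      using orthogonal_to_vector_exists[of p] by auto
    with True r that[of "sgn y"] show ?thesis
      by (simp add: norm_sgn orthogonal_def sgn_div_norm meridian_def) (simp add: r_def)
  next
    case False
    with r that[of "r /\<^sub>R sin \<theta>"] \<theta> show ?thesis
      by (simp add: meridian_def sin_ge_zero) (simp add: r_def)
  qed
  then show ?thesis
    using measure_lune_meridian[OF p v(1,2)] lune_angle_eq \<theta> by (metis \<theta>_def)
qed

section \<open>Sign changes and Rolle's theorem\<close>

text \<open>Ordered intervals, overlapping at most in end points, with strictly opposite signs at
  their ends. Strict signs at finitely many points can be found again on every sufficiently fine
  grid, which is not true of zeros.\<close>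

definition sign_changes :: "(real \<Rightarrow> real) \<Rightarrow> real \<Rightarrow> real \<Rightarrow> nat \<Rightarrow> bool"
  where "sign_changes g a b m \<longleftrightarrow>
    (\<exists>p q. (\<forall>i<m. a \<le> p i \<and> p i < q i \<and> q i \<le> b \<and> g (p i) * g (q i) < 0) \<and>
      (\<forall>i. Suc i < m \<longrightarrow> q i \<le> p (Suc i)))"

text \<open>A nonzero value between neighbouring zeros makes the function leave 0 and return, so
  that Rolle's theorem yields a strict sign change; on a stretch of zeros it would yield
  none.\<close>

definition separated_zeros :: "(real \<Rightarrow> real) \<Rightarrow> real \<Rightarrow> real \<Rightarrow> nat \<Rightarrow> bool"
  where "separated_zeros f a b m \<longleftrightarrow>
    (\<exists>z. (\<forall>i<m. z i \<in> {a..b} \<and> f (z i) = 0) \<and>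
      (\<forall>i. Suc i < m \<longrightarrow> (\<exists>w. z i < w \<and> w < z (Suc i) \<and> f w \<noteq> 0)))"

text \<open>If \<open>f\<close> vanished at all points between two neighbours, the finite zero set
  would contain a whole open interval.\<close>

lemma finite_zeros_imp_separated:
  fixes f :: "real \<Rightarrow> real"
  assumes "finite {s \<in> {a..b}. f s = 0}"
  shows "separated_zeros f a b (card {s \<in> {a..b}. f s = 0})"
proof -
  let ?Z = "{s \<in> {a..b}. f s = 0}"
  define xs where "xs = sorted_list_of_set ?Z"
  have len: "length xs = card ?Z" and set: "set xs = ?Z"
    using assms by (simp_all add: xs_def)
  have z: "xs ! i \<in> ?Z" if "i < card ?Z" for i
    using that len set nth_mem by metis
  have "\<exists>w. xs ! i < w \<and> w < xs ! Suc i \<and> f w \<noteq> 0" if i: "Suc i < card ?Z" for i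
  proof (rule ccontr)
    assume *: "\<not> ?thesis"
    have less: "xs ! i < xs ! Suc i"
      using i len sorted_wrt_nth_less[OF strict_sorted_list_of_set, of i "Suc i" ?Z]
      by (simp add: xs_def)
    have "{xs ! i<..<xs ! Suc i} \<subseteq> ?Z"
    proof
      fix s assume s: "s \<in> {xs ! i<..<xs ! Suc i}"
      then have "f s = 0"
        using * by auto
      moreover have "a \<le> xs ! i" "xs ! Suc i \<le> b"
        using z[of i] z[OF i] i by auto
      ultimately show "s \<in> ?Z"
        using s by auto
    qed
    then show False
      using infinite_Ioo[OF less] finite_subset[OF _ assms] by simp
  qed
  then show ?thesis
    using z unfolding separated_zeros_def by blast
qed

text \<open>The intermediate value theorem puts a zero strictly inside each interval, and the right
  end of the interval is the nonzero value that separates it from the next zero. This prepares the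
  second use of Rolle's theorem.\<close>

lemma sign_changes_imp_zeros:
  assumes cont: "continuous_on {a..b} g" and "sign_changes g a b m"
  shows "separated_zeros g a b m"
proof -
  obtain p q where pq: "\<And>i. i < m \<Longrightarrow> a \<le> p i \<and> p i < q i \<and> q i \<le> b \<and> g (p i) * g (q i) < 0"
      "\<And>i. Suc i < m \<Longrightarrow> q i \<le> p (Suc i)"
    using assms(2) unfolding sign_changes_def by blast
  have "\<exists>z. p i < z \<and> z < q i \<and> g z = 0" if "i < m" for i
  proof -
    note i = pq(1)[OF that]
    have c: "continuous_on {p i..q i} g"
      using i by (intro continuous_on_subset[OF cont]) auto
    have "\<exists>z\<ge>p i. z \<le> q i \<and> g z = 0"
    proof (cases "g (p i) < 0")
      case True
      with i have "g (q i) > 0"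
        by (simp add: mult_less_0_iff)
      with True i show ?thesis
        by (intro IVT' c) auto
    next
      case False
      with i have "g (p i) > 0" "g (q i) < 0"
        by (auto simp: mult_less_0_iff)
      with i show ?thesis
        by (intro IVT2' c) auto
    qed
    then show ?thesis
      using i by (metis less_eq_real_def less_irrefl mult_zero_left mult_zero_right)
  qed
  then obtain z where z: "\<And>i. i < m \<Longrightarrow> p i < z i \<and> z i < q i \<and> g (z i) = 0"
    by metis
  have "z i \<in> {a..b} \<and> g (z i) = 0" if "i < m" for i
    using z[OF that] pq(1)[OF that] by auto
  moreover have "\<exists>w. z i < w \<and> w < z (Suc i) \<and> g w \<noteq> 0" if "Suc i < m" for i
    using z[of i] z[OF that] pq(1)[of i] pq(2)[OF that] that
    by (intro exI[of _ "q i"]) auto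
  ultimately show ?thesis
    unfolding separated_zeros_def by blast
qed

text \<open>Rolle's theorem for D - l: \<open>f' - l * f\<close> has the sign of the derivative of
  exp(-l s) f(s), which has the same zeros as \<open>f\<close>. Between two separated zeros this
  product leaves 0 and returns, so its derivative takes both signs; m zeros leave m - 1
  gaps.\<close>

lemma Rolle_sign_changes:
  assumes der: "\<And>s. s \<in> {a..b} \<Longrightarrow> (f has_real_derivative f' s) (at s within {a..b})"
    and "separated_zeros f a b m"
  shows "sign_changes (\<lambda>s. f' s - l * f s) a b (m - 1)"
proof -
  obtain z where z: "\<And>i. i < m \<Longrightarrow> z i \<in> {a..b} \<and> f (z i) = 0"
      "\<And>i. Suc i < m \<Longrightarrow> \<exists>w. z i < w \<and> w < z (Suc i) \<and> f w \<noteq> 0"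
    using assms(2) unfolding separated_zeros_def by blast
  define g where "g = (\<lambda>s. f' s - l * f s)"
  define F where "F = (\<lambda>s. exp (- l * s) * f s)"
  have F: "(F has_real_derivative exp (- l * s) * g s) (at s within {a..b})" if "s \<in> {a..b}" for s
    unfolding F_def g_def by (auto intro!: derivative_eq_intros der[OF that] simp: algebra_simps)
  have mvt: "\<exists>r. s < r \<and> r < t \<and> F t - F s = (t - s) * (exp (- l * r) * g r)"
    if "a \<le> s" "s < t" "t \<le> b" for s t
  proof -
    have "\<exists>r\<in>{s<..<t}. F t - F s = exp (- l * r) * g r * (t - s)"
    proof (rule mvt_simple[OF \<open>s < t\<close>])
      fix r assume "s \<le> r" "r \<le> t"
      then show "(F has_derivative (\<lambda>x. exp (- l * r) * g r * x)) (at r within {s..t})"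
        using that has_field_derivative_subset[OF F[of r], of "{s..t}"]
        by (auto simp: has_field_derivative_def)
    qed
    then show ?thesis
      by (auto simp: mult.commute)
  qed
  have "\<exists>p q. z i < p \<and> p < q \<and> q < z (Suc i) \<and> g p * g q < 0" if i: "Suc i < m" for i
  proof -
    obtain w where w: "z i < w" "w < z (Suc i)" "f w \<noteq> 0"
      using z(2)[OF i] by blast
    have zi: "a \<le> z i" "f (z i) = 0" "z (Suc i) \<le> b" "f (z (Suc i)) = 0"
      using z(1)[of i] z(1)[OF i] i by auto
    obtain p where p: "z i < p" "p < w" "F w - F (z i) = (w - z i) * (exp (- l * p) * g p)"
      using mvt[of "z i" w] w zi by auto
    obtain q where q: "w < q" "q < z (Suc i)"
        "F (z (Suc i)) - F w = (z (Suc i) - w) * (exp (- l * q) * g q)"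
      using mvt[of w "z (Suc i)"] w zi by auto
    \<comment> \<open>The mean value slopes on the two sides of \<open>w\<close> multiply to
      \<open>- (F w)\<^sup>2\<close> up to this positive factor.\<close>
    define c where "c = (w - z i) * exp (- l * p) * ((z (Suc i) - w) * exp (- l * q))"
    have "c > 0"
      using w by (simp add: c_def)
    have "c * (g p * g q) = (F w - F (z i)) * (F (z (Suc i)) - F w)"
      unfolding p(3) q(3) c_def by (simp add: algebra_simps)
    also have "\<dots> = - (F w)\<^sup>2"
      using zi by (simp add: F_def power2_eq_square)
    also have "\<dots> < 0"
      using w by (simp add: F_def)
    finally have "g p * g q < 0"
      using \<open>c > 0\<close> by (simp add: mult_less_0_iff)
    then show ?thesis
      using p q by (intro exI[of _ p] exI[of _ q]) auto
  qed
  then obtain p q where pq: "\<And>i. Suc i < m \<Longrightarrow>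
      z i < p i \<and> p i < q i \<and> q i < z (Suc i) \<and> g (p i) * g (q i) < 0"
    by metis
  have "a \<le> p i \<and> p i < q i \<and> q i \<le> b \<and> g (p i) * g (q i) < 0" if "i < m - 1" for i
  proof -
    have "i < m" "Suc i < m"
      using that by auto
    then show ?thesis
      using pq[of i] z(1)[of i] z(1)[of "Suc i"] by auto
  qed
  moreover have "q i \<le> p (Suc i)" if "Suc i < m - 1" for i
  proof -
    have "Suc i < m" "Suc (Suc i) < m"
      using that by auto
    then show ?thesis
      using pq[of i] pq[of "Suc i"] by auto
  qed
  ultimately show ?thesis
    unfolding sign_changes_def g_def by blast
qed

text \<open>The condition on \<open>c\<close> says that it keeps one sign, possibly negative. It
  covers the normalisation by 1/|x| as well as a leading coefficient of either sign.\<close>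

lemma sign_changes_mult:
  assumes "sign_changes g a b m"
    and c: "\<And>s t. s \<in> {a..b} \<Longrightarrow> t \<in> {a..b} \<Longrightarrow> 0 < c s * c t"
  shows "sign_changes (\<lambda>s. c s * g s) a b m"
proof -
  obtain p q where pq: "\<forall>i<m. a \<le> p i \<and> p i < q i \<and> q i \<le> b \<and> g (p i) * g (q i) < 0"
      "\<forall>i. Suc i < m \<longrightarrow> q i \<le> p (Suc i)"
    using assms(1) unfolding sign_changes_def by blast
  have "(c (p i) * g (p i)) * (c (q i) * g (q i)) < 0" if "i < m" for i
  proof -
    have "p i \<in> {a..b}" "q i \<in> {a..b}" "g (p i) * g (q i) < 0"
      using pq(1) that by force+
    then have "(c (p i) * c (q i)) * (g (p i) * g (q i)) < 0"
      by (intro mult_pos_neg[OF c])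
    then show ?thesis
      by (simp only: mult_ac)
  qed
  with pq show ?thesis
    unfolding sign_changes_def by (intro exI[of _ p] exI[of _ q]) auto
qed

lemma sign_changes_mono:
  assumes "sign_changes g a b m" "k \<le> m"
  shows "sign_changes g a b k"
proof -
  obtain p q where "\<forall>i<m. a \<le> p i \<and> p i < q i \<and> q i \<le> b \<and> g (p i) * g (q i) < 0"
      "\<forall>i. Suc i < m \<longrightarrow> q i \<le> p (Suc i)"
    using assms(1) unfolding sign_changes_def by blast
  with assms(2) show ?thesis
    unfolding sign_changes_def by (intro exI[of _ p] exI[of _ q]) auto
qed

section \<open>Sign changes seen on a grid\<close>

lemma discrete_sign_change:
  fixes g :: "nat \<Rightarrow> real"
  assumes "j < k" "g j * g k < 0"
  shows "\<exists>i\<ge>j. i < k \<and> g i * g (Suc i) \<le> 0"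
proof (rule ccontr)
  assume *: "\<not> ?thesis"
  have "i \<le> k \<longrightarrow> g j * g i > 0" if "j \<le> i" for i
    using that
  proof (induction i rule: dec_induct)
    case base
    from assms show ?case
      by (auto simp: zero_less_mult_iff mult_less_0_iff)
  next
    case (step i)
    show ?case
    proof
      assume "Suc i \<le> k"
      with step have "g j * g i > 0" "j \<le> i" "i < k"
        by auto
      moreover from this have "g i * g (Suc i) > 0"
        using * not_le by blast
      ultimately show "g j * g (Suc i) > 0"
        by (auto simp: zero_less_mult_iff)
    qed
  qed
  from this[of k] show False
    using assms by simp
qed

text \<open>The outermost nodes inside [p, q] converge to p and q, so by continuity \<open>g\<close>
  has strictly opposite signs at them once the grid is fine, and some step between them carries a
  change. That change is only weak, because \<open>g\<close> may vanish at a node.\<close>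

lemma eventually_grid_sign_change:
  fixes g :: "real \<Rightarrow> real"
  assumes cont: "continuous_on {a..b} g" and pq: "a \<le> p" "p < q" "q \<le> b" "g p * g q < 0"
  shows "\<forall>\<^sub>F M in sequentially. \<exists>k<M. p \<le> grid a b M k \<and> grid a b M (Suc k) \<le> q \<and>
    g (grid a b M k) * g (grid a b M (Suc k)) \<le> 0"
proof -
  have ab: "a < b" using pq by simp
  \<comment> \<open>Index of the first node at or after \<open>p\<close>; \<open>B\<close> is that
    of the last node at or before \<open>q\<close>.\<close>
  define A where "A = (\<lambda>M. nat \<lceil>(p - a) / (b - a) * real M\<rceil>)"
  define B where "B = (\<lambda>M. nat \<lfloor>(q - a) / (b - a) * real M\<rfloor>)"
  define c d where "c = (p - a) / (b - a)" and "d = (q - a) / (b - a)"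
  have cd: "0 \<le> c" "c < d" "d \<le> 1" "p = a + (b - a) * c" "q = a + (b - a) * d"
    using pq ab by (auto simp: c_def d_def divide_strict_right_mono)
  have A: "c * real M \<le> real (A M)" "real (A M) \<le> c * real M + 1" for M
  proof -
    have "0 \<le> c * real M" using cd by simp
    then show "c * real M \<le> real (A M)" "real (A M) \<le> c * real M + 1"
      unfolding A_def c_def[symmetric] by linarith+
  qed
  have B: "real (B M) \<le> d * real M" "d * real M - 1 \<le> real (B M)" for M
  proof -
    have "0 \<le> d * real M" using cd by simp
    then show "real (B M) \<le> d * real M" "d * real M - 1 \<le> real (B M)"
      unfolding B_def d_def[symmetric] by linarith+
  qed
  have limA: "(\<lambda>M. grid a b M (A M)) \<longlonglongrightarrow> p"
  proof -
    have "(\<lambda>M. real (A M) / real M) \<longlonglongrightarrow> c"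
    proof (rule tendsto_sandwich)
      show "\<forall>\<^sub>F M in sequentially. c \<le> real (A M) / real M"
        using A by (intro eventually_sequentiallyI[of 1]) (auto simp: field_simps)
      show "\<forall>\<^sub>F M in sequentially. real (A M) / real M \<le> c + 1 / real M"
        using A by (intro eventually_sequentiallyI[of 1]) (auto simp: field_simps)
      show "(\<lambda>M. c + 1 / real M) \<longlonglongrightarrow> c"
        by real_asymp
    qed simp
    then have "(\<lambda>M. a + (b - a) * (real (A M) / real M)) \<longlonglongrightarrow> a + (b - a) * c"
      by (intro tendsto_intros)
    then show ?thesis
      by (simp add: grid_def cd)
  qed
  have limB: "(\<lambda>M. grid a b M (B M)) \<longlonglongrightarrow> q"
  proof -
    have "(\<lambda>M. real (B M) / real M) \<longlonglongrightarrow> d"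
    proof (rule tendsto_sandwich)
      show "\<forall>\<^sub>F M in sequentially. d - 1 / real M \<le> real (B M) / real M"
      proof (intro eventually_sequentiallyI[of 1])
        fix M :: nat assume "1 \<le> M"
        then have "d - 1 / real M = (d * real M - 1) / real M"
          by (simp add: diff_divide_distrib)
        also have "\<dots> \<le> real (B M) / real M"
          by (intro divide_right_mono B) simp
        finally show "d - 1 / real M \<le> real (B M) / real M" .
      qed
      show "\<forall>\<^sub>F M in sequentially. real (B M) / real M \<le> d"
        using B by (intro eventually_sequentiallyI[of 1]) (auto simp: field_simps)
      show "(\<lambda>M. d - 1 / real M) \<longlonglongrightarrow> d"
        by real_asymp
    qed simp
    then have "(\<lambda>M. a + (b - a) * (real (B M) / real M)) \<longlonglongrightarrow> a + (b - a) * d"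
      by (intro tendsto_intros)
    then show ?thesis
      by (simp add: grid_def cd)
  qed
  have geA: "p \<le> grid a b M (A M)" if "M > 0" for M
  proof -
    have "c \<le> real (A M) / real M"
      using A(1)[of M] that by (simp add: pos_le_divide_eq)
    then have "(b - a) * c \<le> (b - a) * (real (A M) / real M)"
      using ab by (intro mult_left_mono) auto
    then show ?thesis
      by (simp add: grid_def cd(4))
  qed
  have leB: "grid a b M (B M) \<le> q" if "M > 0" for M
  proof -
    have "real (B M) / real M \<le> d"
      using B(1)[of M] that by (simp add: pos_divide_le_eq)
    then have "(b - a) * (real (B M) / real M) \<le> (b - a) * d"
      using ab by (intro mult_left_mono) auto
    then show ?thesis
      by (simp add: grid_def cd(5))
  qed
  have leb: "B M \<le> M" for M
  proof -
    have "real (B M) \<le> 1 * real M"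
      using B(1)[of M] cd by (meson mult_right_mono of_nat_0_le_iff order_trans)
    then show ?thesis by simp
  qed
  have "(\<lambda>M. grid a b M (B M) - grid a b M (A M)) \<longlonglongrightarrow> q - p"
    by (intro tendsto_intros limA limB)
  then have less: "\<forall>\<^sub>F M in sequentially. 0 < grid a b M (B M) - grid a b M (A M)"
    using pq by (intro order_tendstoD(1)) auto
  have pos: "\<forall>\<^sub>F M::nat in sequentially. 0 < M"
    by (rule eventually_gt_at_top)
  have inA: "\<forall>\<^sub>F M in sequentially. grid a b M (A M) \<in> {a..b}"
    using less pos
  proof eventually_elim
    case (elim M)
    with geA[of M] leB[of M] pq show ?case by simp
  qed
  have inB: "\<forall>\<^sub>F M in sequentially. grid a b M (B M) \<in> {a..b}"
    using less pos
  proof eventually_elim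
    case (elim M)
    with geA[of M] leB[of M] pq show ?case by simp
  qed
  have "p \<in> {a..b}" "q \<in> {a..b}"
    using pq by auto
  then have "(\<lambda>M. g (grid a b M (A M))) \<longlonglongrightarrow> g p" "(\<lambda>M. g (grid a b M (B M))) \<longlonglongrightarrow> g q"
    using continuous_on_tendsto_compose[OF cont limA _ inA] continuous_on_tendsto_compose[OF cont limB _ inB]
    by blast+
  then have "(\<lambda>M. g (grid a b M (A M)) * g (grid a b M (B M))) \<longlonglongrightarrow> g p * g q"
    by (simp add: tendsto_mult)
  then have neg: "\<forall>\<^sub>F M in sequentially. g (grid a b M (A M)) * g (grid a b M (B M)) < 0"
    by (rule order_tendstoD(2)) (rule pq(4))
  show ?thesis
    using less pos neg
  proof eventually_elim
    case (elim M)
    have "A M < B M"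
    proof (rule ccontr)
      assume "\<not> A M < B M"
      then have "grid a b M (B M) \<le> grid a b M (A M)"
        using ab by (intro grid_mono) auto
      with elim(1) show False by simp
    qed
    from discrete_sign_change[OF this, of "\<lambda>k. g (grid a b M k)"] elim(3)
    obtain k where k: "A M \<le> k" "k < B M" "g (grid a b M k) * g (grid a b M (Suc k)) \<le> 0"
      by blast
    have "p \<le> grid a b M k"
      using geA[OF elim(2)] grid_mono[of a b "A M" k M] k ab by linarith
    moreover have "grid a b M (Suc k) \<le> q"
      using leB[OF elim(2)] grid_mono[of a b "Suc k" "B M" M] k ab by linarith
    ultimately show ?case
      using k(3) less_le_trans[OF k(2) leb[of M]] by blast
  qed
qed

lemma eventually_grid_sign_changes:
  assumes cont: "continuous_on {a..b} g" and "sign_changes g a b m"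
  shows "\<forall>\<^sub>F M in sequentially.
    m \<le> card {k. k < M \<and> g (grid a b M k) * g (grid a b M (Suc k)) \<le> 0}"
proof -
  obtain p q where pq: "\<And>i. i < m \<Longrightarrow> a \<le> p i \<and> p i < q i \<and> q i \<le> b \<and> g (p i) * g (q i) < 0"
      "\<And>i. Suc i < m \<Longrightarrow> q i \<le> p (Suc i)"
    using assms(2) unfolding sign_changes_def by blast
  have mono: "q i \<le> p j" if "i < j" "j < m" for i j
    using that
  proof (induction j)
    case (Suc j)
    show ?case
    proof (cases "i = j")
      case True
      then show ?thesis using pq(2) Suc.prems by simp
    next
      case False
      then have "q i \<le> p j" using Suc by simp
      also have "p j \<le> q j" using pq(1)[of j] Suc.prems by simp
      also have "q j \<le> p (Suc j)" using pq(2) Suc.prems by simp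
      finally show ?thesis .
    qed
  qed simp
  have "\<forall>\<^sub>F M in sequentially. \<forall>i\<in>{..<m}. \<exists>k<M. p i \<le> grid a b M k \<and>
      grid a b M (Suc k) \<le> q i \<and> g (grid a b M k) * g (grid a b M (Suc k)) \<le> 0"
    using pq by (intro eventually_ball_finite ballI eventually_grid_sign_change[OF cont]) auto
  then show ?thesis
  proof eventually_elim
    case (elim M)
    then obtain k where k: "\<And>i. i < m \<Longrightarrow> k i < M \<and> p i \<le> grid a b M (k i) \<and>
        grid a b M (Suc (k i)) \<le> q i \<and> g (grid a b M (k i)) * g (grid a b M (Suc (k i))) \<le> 0"
      by (metis lessThan_iff)
    \<comment> \<open>The intervals of different sign changes share at most an end point, so the
      grid steps found inside them are distinct and can be counted.\<close>
    have "k i < k j" if "i < j" "j < m" for i j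
    proof -
      have ab: "a < b"
        using pq(1)[OF \<open>j < m\<close>] by linarith
      have i: "i < m"
        using that by simp
      have "grid a b M (k i) < grid a b M (Suc (k i))"
        using k[OF i] ab by (intro grid_strict_mono) auto
      also have "\<dots> \<le> grid a b M (k j)"
        using k[OF i] k[OF \<open>j < m\<close>] mono[OF that] by linarith
      finally show ?thesis
        using grid_mono[of a b "k j" "k i" M] ab by linarith
    qed
    then have "inj_on k {..<m}"
      by (intro linorder_inj_onI) (auto simp: less_le)
    moreover have "k ` {..<m} \<subseteq> {k. k < M \<and> g (grid a b M k) * g (grid a b M (Suc k)) \<le> 0}"
      using k by auto
    ultimately show ?case
      using card_mono[of "{k. k < M \<and> g (grid a b M k) * g (grid a b M (Suc k)) \<le> 0}" "k ` {..<m}"]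
      by (simp add: card_image)
  qed
qed

section \<open>The cone\<close>

text \<open>Derivative of x/|x|: the part of \<open>x'\<close> orthogonal to \<open>x\<close>,
  divided by |x|.\<close>

definition unit_deriv :: "'a::real_inner \<Rightarrow> 'a \<Rightarrow> 'a"
  where "unit_deriv x x' = (1 / norm x) *\<^sub>R x' - ((x \<bullet> x') / norm x ^ 3) *\<^sub>R x"

lemma has_vector_derivative_normalized:
  fixes x :: "real \<Rightarrow> 'a::real_inner"
  assumes "(x has_vector_derivative x') (at s within S)" and "x s \<noteq> 0"
  shows "((\<lambda>s. x s /\<^sub>R norm (x s)) has_vector_derivative unit_deriv (x s) x') (at s within S)"
proof -
  have "((\<lambda>s. x s \<bullet> x s) has_derivative (\<lambda>h. x s \<bullet> (h *\<^sub>R x') + (h *\<^sub>R x') \<bullet> x s)) (at s within S)"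
    using assms(1) unfolding has_vector_derivative_def by (intro has_derivative_inner) auto
  then have inner: "((\<lambda>s. x s \<bullet> x s) has_real_derivative 2 * (x s \<bullet> x')) (at s within S)"
    unfolding has_field_derivative_def
    by (rule has_derivative_eq_rhs) (auto simp: inner_commute algebra_simps)
  have pos: "x s \<bullet> x s > 0"
    using assms(2) by simp
  have "((\<lambda>s. sqrt (x s \<bullet> x s)) has_real_derivative
      inverse (sqrt (x s \<bullet> x s)) / 2 * (2 * (x s \<bullet> x'))) (at s within S)"
    by (rule DERIV_chain2[where f = sqrt and g = "\<lambda>s. x s \<bullet> x s" and x = s,
          OF DERIV_real_sqrt[OF pos] inner])
  moreover have "inverse (norm (x s)) / 2 * (2 * (x s \<bullet> x')) = (x s \<bullet> x') / norm (x s)"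
    using assms(2) by (simp add: field_simps)
  ultimately have "((\<lambda>s. norm (x s)) has_real_derivative (x s \<bullet> x') / norm (x s)) (at s within S)"
    unfolding norm_eq_sqrt_inner by (rule DERIV_cong)
  from DERIV_inverse'[OF this] assms(2)
  have "((\<lambda>s. inverse (norm (x s))) has_real_derivative
      - (inverse (norm (x s)) * ((x s \<bullet> x') / norm (x s)) * inverse (norm (x s)))) (at s within S)"
    by simp
  also have "- (inverse (norm (x s)) * ((x s \<bullet> x') / norm (x s)) * inverse (norm (x s)))
      = - (x s \<bullet> x') / norm (x s) ^ 3"
    by (simp add: divide_inverse power3_eq_cube)
  finally have "((\<lambda>s. inverse (norm (x s))) has_real_derivative
      - (x s \<bullet> x') / norm (x s) ^ 3) (at s within S)" .
  from has_vector_derivative_scaleR[OF this assms(1)] show ?thesis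
    by (simp add: unit_deriv_def inverse_eq_divide)
qed

text \<open>The numerator is the Gram determinant of \<open>x\<close> and \<open>x'\<close>; in
  dimension three the formula reads |x \<times> x'|^2 / |x|^4.\<close>

lemma norm_unit_deriv:
  assumes "x \<noteq> 0"
  shows "(norm (unit_deriv x x'))\<^sup>2 = ((x \<bullet> x) * (x' \<bullet> x') - (x \<bullet> x')\<^sup>2) / (x \<bullet> x)\<^sup>2"
proof -
  define N where "N = norm x"
  have N: "N \<noteq> 0" "x \<bullet> x = N\<^sup>2"
    using assms by (simp_all add: N_def power2_norm_eq_inner)
  have "(norm (unit_deriv x x'))\<^sup>2 =
      (x' \<bullet> x') / N\<^sup>2 - 2 * (x \<bullet> x')\<^sup>2 / N ^ 4 + (x \<bullet> x')\<^sup>2 * N\<^sup>2 / N ^ 6"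
    unfolding power2_norm_eq_inner unit_deriv_def N_def[symmetric]
    using N by (simp add: inner_simps inner_commute[of x' x] field_simps eval_nat_numeral)
  also have "\<dots> = ((x \<bullet> x) * (x' \<bullet> x') - (x \<bullet> x')\<^sup>2) / (x \<bullet> x)\<^sup>2"
    using N by (simp add: field_simps eval_nat_numeral)
  finally show ?thesis .
qed

lemma continuous_on_unit_deriv:
  assumes "continuous_on S x" "continuous_on S x'" "\<And>s. s \<in> S \<Longrightarrow> x s \<noteq> 0"
  shows "continuous_on S (\<lambda>s. unit_deriv (x s) (x' s))"
  unfolding unit_deriv_def using assms by (intro continuous_intros) auto

text \<open>Phase vectors live in a product type, whereas lunes and orthogonal maps are treated in
  \<open>real^3\<close>. The transfer preserves inner products, so lengths and angles may be
  computed on either side.\<close>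

definition vec3 :: "real \<times> real \<times> real \<Rightarrow> real^3"
  where "vec3 x = vector [fst x, fst (snd x), snd (snd x)]"

lemma inner_vec3: "n \<bullet> vec3 (x, y, z) = n $ 1 * x + n $ 2 * y + n $ 3 * z"
  by (simp add: vec3_def inner_vec_def sum_3)

lemma inner_vec3_vec3 [simp]: "vec3 p \<bullet> vec3 q = p \<bullet> q"
  by (simp add: vec3_def inner_vec_def sum_3 inner_prod_def)

lemma norm_vec3 [simp]: "norm (vec3 p) = norm p"
  by (simp add: norm_eq_sqrt_inner)

lemma inner_vec3_scaleR [simp]: "n \<bullet> vec3 (c *\<^sub>R p) = c * (n \<bullet> vec3 p)"
  by (simp add: vec3_def inner_vec_def sum_3 algebra_simps)

text \<open>With this parameter the pairing with a normal is a binary quadratic form in (sin, cos), and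
  one turn of the cone x0 x2 = x1^2 takes only a half turn.\<close>
definition conic :: "real \<Rightarrow> real \<times> real \<times> real"
  where "conic \<beta> = ((sin \<beta>)\<^sup>2, sin \<beta> * cos \<beta>, (cos \<beta>)\<^sup>2)"

definition conic' :: "real \<Rightarrow> real \<times> real \<times> real"
  where "conic' \<beta> = (2 * sin \<beta> * cos \<beta>, (cos \<beta>)\<^sup>2 - (sin \<beta>)\<^sup>2, - 2 * sin \<beta> * cos \<beta>)"

lemma conic_has_derivative: "(conic has_vector_derivative conic' \<beta>) (at \<beta> within S)"
  unfolding conic_def [abs_def] conic'_def
  by (intro has_vector_derivative_Pair)
    (auto simp: has_real_derivative_iff_has_vector_derivative[symmetric] power2_eq_square
      intro!: derivative_eq_intros)

lemma cos_4: "cos (4 * \<beta>) = 1 - 8 * (sin \<beta>)\<^sup>2 * (cos \<beta>)\<^sup>2" for \<beta> :: real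
proof -
  have "cos (4 * \<beta>) = cos (2 * (2 * \<beta>))"
    by simp
  also have "\<dots> = 1 - 2 * (sin (2 * \<beta>))\<^sup>2"
    by (rule cos_double_sin)
  finally show ?thesis
    by (simp add: sin_double power_mult_distrib)
qed

lemma continuous_on_conic: "continuous_on S conic"
  unfolding conic_def [abs_def] by (intro continuous_intros)

text \<open>All three reduce to sin^2 cos^2 = (1 - cos(4\<beta>))/8. The pairing in the third is
  half the derivative of the first, namely -sin(4\<beta>)/4; squaring makes it a polynomial in
  cos(4\<beta>).\<close>

lemma inner_conic:
  "conic \<beta> \<bullet> conic \<beta> = (7 + cos (4 * \<beta>)) / 8"
  "conic' \<beta> \<bullet> conic' \<beta> = (3 - cos (4 * \<beta>)) / 2"
  "(conic \<beta> \<bullet> conic' \<beta>)\<^sup>2 = (1 - (cos (4 * \<beta>))\<^sup>2) / 16"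
  using sin_cos_squared_add[of \<beta>]
  unfolding conic_def conic'_def inner_prod_def cos_4 fst_conv snd_conv inner_real_def
  by algebra+

lemma conic_nonzero: "conic \<beta> \<noteq> 0"
proof -
  have "7 + cos (4 * \<beta>) > 0"
    using cos_ge_minus_one[of "4 * \<beta>"] by linarith
  then have "conic \<beta> \<bullet> conic \<beta> > 0"
    unfolding inner_conic by simp
  then show ?thesis by auto
qed

lemma norm_unit_deriv_conic:
  "norm (unit_deriv (conic \<beta>) (conic' \<beta>)) = 4 * (sqrt (5 - cos (4 * \<beta>)) / (7 + cos (4 * \<beta>)))"
proof -
  define C where "C = cos (4 * \<beta>)"
  have C: "-1 \<le> C" "C \<le> 1"
    by (simp_all add: C_def)
  have "(norm (unit_deriv (conic \<beta>) (conic' \<beta>)))\<^sup>2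
      = ((7 + C) / 8 * ((3 - C) / 2) - (1 - C\<^sup>2) / 16) / ((7 + C) / 8)\<^sup>2"
    unfolding norm_unit_deriv[OF conic_nonzero] inner_conic C_def ..
  \<comment> \<open>The C^2 terms cancel: (7 + C)(3 - C) - (1 - C^2) = 4(5 - C).\<close>
  also have "\<dots> = (4 * (sqrt (5 - C) / (7 + C)))\<^sup>2"
    using C by (simp add: power_mult_distrib power_divide divide_simps) (simp add: algebra_simps power2_eq_square)
  finally show ?thesis
    using C unfolding C_def[symmetric] by (subst (asm) power2_eq_iff_nonneg) auto
qed

lemma continuous_on_norm_conic: "continuous_on S (\<lambda>\<alpha>::real. sqrt (5 - cos \<alpha>) / (7 + cos \<alpha>))"
proof -
  have "7 + cos \<alpha> \<noteq> 0" for \<alpha> :: real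
    using cos_ge_minus_one[of \<alpha>] by linarith
  then show ?thesis
    by (intro continuous_intros) auto
qed

text \<open>Substituting \<alpha> = 4\<beta> spreads one turn of the cone over [0, 4 pi]. The
  integrand is even with period 2 pi, so this amounts to four copies of the integral over [0, pi],
  whence the 4 in \<open>L_Omega\<close>.\<close>

lemma integral_norm_unit_deriv_conic:
  "integral {0..pi} (\<lambda>\<beta>. norm (unit_deriv (conic \<beta>) (conic' \<beta>))) = L_Omega"
proof -
  define f where "f = (\<lambda>\<alpha>::real. sqrt (5 - cos \<alpha>) / (7 + cos \<alpha>))"
  define I where "I = integral {0..pi} f"
  have 0: "(f has_integral I) {0..pi}"
    unfolding I_def f_def
    by (intro integrable_integral integrable_continuous_real continuous_on_norm_conic)
  have "((\<lambda>x. f (- x)) has_integral I) {- pi..0}"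
    using has_integral_reflect_lemma_real[OF 0] by simp
  then have 1: "(f has_integral I) {- pi..0}"
    by (simp add: f_def)
  have 2: "(f has_integral I + I) {- pi..pi}"
    by (rule has_integral_combine[OF _ _ 1 0]) auto
  have shift: "f (x - 2 * pi) = f x" "f (x - 4 * pi) = f x" for x
  proof -
    show "f (x - 2 * pi) = f x"
      by (simp add: f_def cos_diff)
    have "f (x - 4 * pi) = f ((x - 2 * pi) - 2 * pi)"
      by (simp add: algebra_simps)
    then show "f (x - 4 * pi) = f x"
      by (simp add: f_def cos_diff)
  qed
  have 3: "(f has_integral I + I) {pi..3 * pi}"
    using has_integral_affinity'[of f "I + I" "- pi" pi 1 "- 2 * pi"] 2 by (simp add: shift)
  have 4: "(f has_integral I) {3 * pi..4 * pi}"
    using has_integral_affinity'[of f I "- pi" 0 1 "- 4 * pi"] 1 by (simp add: shift)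
  have "(f has_integral I + (I + I)) {0..3 * pi}"
    by (rule has_integral_combine[OF _ _ 0 3]) auto
  then have "(f has_integral I + (I + I) + I) {0..4 * pi}"
    by (rule has_integral_combine[OF _ _ _ 4, rotated 2]) auto
  then have "((\<lambda>\<beta>. f (4 * \<beta>)) has_integral I) {0..pi}"
    using has_integral_affinity'[of f "I + (I + I) + I" 0 "4 * pi" 4 0] by simp
  then have "((\<lambda>\<beta>. 4 * f (4 * \<beta>)) has_integral 4 * I) {0..pi}"
    by (rule has_integral_mult_right)
  then have "integral {0..pi} (\<lambda>\<beta>. 4 * f (4 * \<beta>)) = 4 * I"
    by (rule integral_unique)
  then show ?thesis
    by (simp only: norm_unit_deriv_conic L_Omega_def f_def I_def)
qed

text \<open>The numerator is at least 2 and the denominator at most 8, both extremes being at cos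
  \<alpha> = 1.\<close>

lemma L_Omega_pos: "L_Omega > 0"
proof -
  have "1 / 4 \<le> sqrt (5 - cos \<alpha>) / (7 + cos \<alpha>)" for \<alpha> :: real
  proof -
    have c: "-1 \<le> cos \<alpha>" "cos \<alpha> \<le> 1"
      by simp_all
    then have "sqrt (2\<^sup>2) \<le> sqrt (5 - cos \<alpha>)"
      by (intro real_sqrt_le_mono) simp
    then have "2 \<le> sqrt (5 - cos \<alpha>)"
      by simp
    moreover have "1 / 4 * (7 + cos \<alpha>) \<le> 2"
      using c by simp
    ultimately have "1 / 4 * (7 + cos \<alpha>) \<le> sqrt (5 - cos \<alpha>)"
      by (rule order_trans[rotated])
    moreover have "7 + cos \<alpha> > 0"
      using c by linarith
    ultimately show ?thesis
      by (simp only: pos_le_divide_eq)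
  qed
  then have "integral {0..pi} (\<lambda>\<alpha>::real. 1 / 4 :: real) \<le> integral {0..pi} (\<lambda>\<alpha>. sqrt (5 - cos \<alpha>) / (7 + cos \<alpha>))"
    by (intro integral_le integrable_continuous_real continuous_on_norm_conic) auto
  then have "pi \<le> L_Omega"
    by (simp add: L_Omega_def mult.commute)
  then show ?thesis
    by (rule less_le_trans[OF pi_gt_zero])
qed

definition hyperbolic_normals :: "(real^3) set"
  where "hyperbolic_normals = {n \<in> ball 0 1. 4 * n $ 1 * n $ 3 < (n $ 2)\<^sup>2}"

lemma lmeasurable_hyperbolic_normals [simp]: "hyperbolic_normals \<in> lmeasurable"
  unfolding hyperbolic_normals_def
  by (intro lmeasurable_ball_Collect borel_open open_Collect_less continuous_intros)

section \<open>Zeros of a linear form along the cone\<close>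

lemma continuous_on_inner_conic: "continuous_on S (\<lambda>\<beta>. n \<bullet> vec3 (conic \<beta>))"
  unfolding conic_def inner_vec3 by (intro continuous_intros)

text \<open>Completing the square: the pairing with \<open>conic\<close> is a binary quadratic form,
  semidefinite when its discriminant is not positive. Planes with such normals contribute no strict
  crossing of the cone.\<close>

lemma elliptic_form_semidefinite:
  assumes "(n $ 2)\<^sup>2 \<le> 4 * n $ 1 * n $ 3"
  shows "0 \<le> (n \<bullet> vec3 (conic \<alpha>)) * (n \<bullet> vec3 (conic \<beta>))"
proof (cases "n $ 1 = 0")
  case True
  with assms have "n $ 2 = 0" by simp
  then have "(n \<bullet> vec3 (conic \<alpha>)) * (n \<bullet> vec3 (conic \<beta>)) = (n $ 3 * cos \<alpha> * cos \<beta>)\<^sup>2"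
    using True by (simp add: conic_def inner_vec3 power2_eq_square)
  then show ?thesis by simp
next
  case False
  have *: "0 \<le> 4 * n $ 1 * (n \<bullet> vec3 (conic \<beta>))" for \<beta>
  proof -
    have "4 * n $ 1 * (n \<bullet> vec3 (conic \<beta>))
        = (2 * n $ 1 * sin \<beta> + n $ 2 * cos \<beta>)\<^sup>2 + (4 * n $ 1 * n $ 3 - (n $ 2)\<^sup>2) * (cos \<beta>)\<^sup>2"
      by (simp add: conic_def inner_vec3 power2_eq_square algebra_simps)
    then show ?thesis
      using assms by simp
  qed
  have "0 \<le> (4 * n $ 1 * (n \<bullet> vec3 (conic \<alpha>))) * (4 * n $ 1 * (n \<bullet> vec3 (conic \<beta>)))"
    by (intro mult_nonneg_nonneg *)
  also have "\<dots> = (4 * n $ 1)\<^sup>2 * ((n \<bullet> vec3 (conic \<alpha>)) * (n \<bullet> vec3 (conic \<beta>)))"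
    by (simp add: power2_eq_square)
  finally show ?thesis
    using False by (simp add: zero_le_mult_iff)
qed

text \<open>Equal cotangents give sin(x - y) = 0, while |x - y| < pi.\<close>

lemma cot_inj_on: "inj_on (\<lambda>x. cos x / sin x) {0<..<pi}"
proof (rule inj_onI)
  fix x y :: real
  assume xy: "x \<in> {0<..<pi}" "y \<in> {0<..<pi}" "cos x / sin x = cos y / sin y"
  then have "sin x > 0" "sin y > 0"
    by (simp_all add: sin_gt_zero)
  then have "sin x \<noteq> 0" "sin y \<noteq> 0"
    by simp_all
  from frac_eq_eq[OF this, of "cos x" "cos y"] xy(3) have "cos x * sin y = cos y * sin x"
    by blast
  then have "sin (x - y) = 0"
    using sin_diff[of x y] by algebra
  with xy have "x - y = 0"
    using sin_eq_0_pi[of "x - y"] by simp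
  then show "x = y" by simp
qed

text \<open>Division by sin^2 turns the form into the polynomial \<open>P\<close> of degree at most
  2 in cot \<beta>, and the cotangent is injective on the open interval. The hypothesis rules out
  the zero polynomial.\<close>

lemma card_zeros_conic:
  assumes "n \<bullet> vec3 (conic \<alpha>) \<noteq> 0"
  shows "finite {\<beta> \<in> {0<..<pi}. n \<bullet> vec3 (conic \<beta>) = 0}"
    and "card {\<beta> \<in> {0<..<pi}. n \<bullet> vec3 (conic \<beta>) = 0} \<le> 2"
proof -
  define P where "P = [:n $ 1, n $ 2, n $ 3:]"
  let ?Z = "{\<beta> \<in> {0<..<pi}. n \<bullet> vec3 (conic \<beta>) = 0}"
  have "P \<noteq> 0"
    using assms by (auto simp: P_def conic_def inner_vec3)
  have inj: "inj_on (\<lambda>x. cos x / sin x) ?Z"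
    by (rule inj_on_subset[OF cot_inj_on]) auto
  have sub: "(\<lambda>x. cos x / sin x) ` ?Z \<subseteq> {t. poly P t = 0}"
  proof clarsimp
    fix x :: real assume x: "0 < x" "x < pi" "n \<bullet> vec3 (conic x) = 0"
    then have "sin x > 0" by (simp add: sin_gt_zero)
    then have "poly P (cos x / sin x) = (n \<bullet> vec3 (conic x)) / (sin x)\<^sup>2"
      by (simp add: P_def conic_def inner_vec3 field_simps power2_eq_square)
    with x show "poly P (cos x / sin x) = 0" by simp
  qed
  have fin: "finite {t. poly P t = 0}"
    by (rule poly_roots_finite[OF \<open>P \<noteq> 0\<close>])
  show "finite ?Z"
    using finite_subset[OF sub fin] finite_image_iff[OF inj] by simp
  have "card ?Z = card ((\<lambda>x. cos x / sin x) ` ?Z)"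
    by (rule card_image[OF inj, symmetric])
  also have "\<dots> \<le> card {t. poly P t = 0}"
    by (rule card_mono[OF fin sub])
  also have "\<dots> \<le> degree P"
    by (rule card_poly_roots_bound[OF \<open>P \<noteq> 0\<close>])
  also have "\<dots> \<le> 2"
    by (simp add: P_def)
  finally show "card ?Z \<le> 2" .
qed

text \<open>A strict change has a zero in the interior of its grid step. Hence zeros of different
  steps differ, and none is at 0 or pi, where the cotangent has a pole.\<close>

lemma card_sign_changes_conic:
  "card {k. k < M \<and> (n \<bullet> vec3 (conic (grid 0 pi M k))) * (n \<bullet> vec3 (conic (grid 0 pi M (Suc k)))) < 0} \<le> 2"
proof -
  define g where "g = (\<lambda>\<beta>. n \<bullet> vec3 (conic \<beta>))"
  define K where "K = {k. k < M \<and> g (grid 0 pi M k) * g (grid 0 pi M (Suc k)) < 0}"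
  have "card K \<le> 2"
  proof (cases "K = {}")
    case False
    then obtain k0 where "g (grid 0 pi M k0) \<noteq> 0"
      unfolding K_def by force
    note zeros = card_zeros_conic[OF this[unfolded g_def], folded g_def]
    have "\<exists>z. grid 0 pi M k < z \<and> z < grid 0 pi M (Suc k) \<and> g z = 0" if "k \<in> K" for k
    proof -
      have "M > 0" "g (grid 0 pi M k) * g (grid 0 pi M (Suc k)) < 0"
        using that by (auto simp: K_def)
      then have "sign_changes g (grid 0 pi M k) (grid 0 pi M (Suc k)) 1"
        unfolding sign_changes_def using grid_strict_mono[of 0 pi M k "Suc k"]
        by (intro exI[of _ "\<lambda>_. grid 0 pi M k"] exI[of _ "\<lambda>_. grid 0 pi M (Suc k)"]) auto
      then have "separated_zeros g (grid 0 pi M k) (grid 0 pi M (Suc k)) 1"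
        by (intro sign_changes_imp_zeros) (auto simp: g_def continuous_on_inner_conic)
      then obtain z where "z \<in> {grid 0 pi M k..grid 0 pi M (Suc k)}" "g z = 0"
        unfolding separated_zeros_def by auto
      moreover from this \<open>g (grid 0 pi M k) * _ < 0\<close> have "z \<noteq> grid 0 pi M k" "z \<noteq> grid 0 pi M (Suc k)"
        by auto
      ultimately show ?thesis
        by (intro exI[of _ z]) auto
    qed
    then obtain z where z: "\<And>k. k \<in> K \<Longrightarrow> grid 0 pi M k < z k \<and> z k < grid 0 pi M (Suc k) \<and> g (z k) = 0"
      by metis
    have less: "z j < z k" if "j \<in> K" "k \<in> K" "j < k" for j k
    proof -
      have "grid 0 pi M (Suc j) \<le> grid 0 pi M k"
        using that by (intro grid_mono) auto
      then show ?thesis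
        using z[OF that(1)] z[OF that(2)] by linarith
    qed
    have inj: "inj_on z K"
    proof (rule linorder_inj_onI)
      fix j k assume "j < k" "j \<in> K" "k \<in> K"
      then show "z j \<noteq> z k"
        using less by force
    qed auto
    have "z ` K \<subseteq> {\<beta> \<in> {0<..<pi}. g \<beta> = 0}"
    proof
      fix \<beta> assume "\<beta> \<in> z ` K"
      then obtain k where k: "k \<in> K" "\<beta> = z k" by auto
      then have "k < M" by (simp add: K_def)
      then have "0 \<le> grid 0 pi M k" "grid 0 pi M (Suc k) \<le> pi"
        using grid_bounds[of 0 pi k M] grid_bounds[of 0 pi "Suc k" M] by auto
      then show "\<beta> \<in> {\<beta> \<in> {0<..<pi}. g \<beta> = 0}"
        using z[OF k(1)] k(2) by auto
    qed
    then have "card (z ` K) \<le> 2"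
      using card_mono[OF zeros(1), of "z ` K"] zeros(2) by (simp add: g_def)
    then show ?thesis
      by (simp add: card_image[OF inj])
  qed simp
  then show ?thesis
    by (simp add: K_def g_def)
qed

section \<open>The average over normals for the cone\<close>

definition unit_conic :: "real \<Rightarrow> real \<times> real \<times> real"
  where "unit_conic \<beta> = conic \<beta> /\<^sub>R norm (conic \<beta>)"

lemma open_lune_normalize:
  assumes "p \<noteq> 0" "q \<noteq> 0"
  shows "n \<in> open_lune (vec3 (p /\<^sub>R norm p)) (vec3 (q /\<^sub>R norm q)) \<longleftrightarrow>
    n \<in> ball 0 1 \<and> (n \<bullet> vec3 p) * (n \<bullet> vec3 q) < 0"
proof -
  have "(n \<bullet> vec3 (p /\<^sub>R norm p)) * (n \<bullet> vec3 (q /\<^sub>R norm q))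
      = (n \<bullet> vec3 p) * (n \<bullet> vec3 q) / (norm p * norm q)"
    by (simp add: divide_inverse)
  moreover have "norm p * norm q > 0"
    using assms by simp
  ultimately show ?thesis
    by (simp add: open_lune_def divide_less_0_iff)
qed

text \<open>The number of polygon edges strictly crossed by the plane of \<open>n\<close> is
  integrated over the ball. The total is a sum of lune volumes, hence proportional to the angle sum
  of the polygon, while the integrand is at most 2 on hyperbolic normals and 0 elsewhere.\<close>

lemma lune_const_L_Omega_le: "lune_const * L_Omega \<le> 2 * measure lebesgue hyperbolic_normals"
proof -
  let ?A = "\<lambda>M. \<Sum>k<M. arccos (unit_conic (grid 0 pi M k) \<bullet> unit_conic (grid 0 pi M (Suc k)))"
  have unit: "norm (unit_conic \<beta>) = 1" for \<beta>
    by (simp add: unit_conic_def conic_nonzero)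
  have der: "(unit_conic has_vector_derivative unit_deriv (conic \<beta>) (conic' \<beta>)) (at \<beta> within S)" for \<beta> S
    unfolding unit_conic_def [abs_def]
    by (intro has_vector_derivative_normalized conic_has_derivative conic_nonzero)
  have "continuous_on {0..pi} (\<lambda>\<beta>. unit_deriv (conic \<beta>) (conic' \<beta>))"
    unfolding conic'_def
    by (intro continuous_on_unit_deriv conic_nonzero continuous_intros continuous_on_conic)
  from angle_sum_tendsto_length[OF pi_gt_zero der this] unit
  have lim: "?A \<longlonglongrightarrow> L_Omega"
    by (simp add: integral_norm_unit_deriv_conic)
  have bound: "lune_const * ?A M \<le> 2 * measure lebesgue hyperbolic_normals" for M
  proof -
    let ?D = "\<lambda>k. open_lune (vec3 (unit_conic (grid 0 pi M k))) (vec3 (unit_conic (grid 0 pi M (Suc k))))"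
    have D: "n \<in> ?D k \<longleftrightarrow> n \<in> ball 0 1 \<and>
        (n \<bullet> vec3 (conic (grid 0 pi M k))) * (n \<bullet> vec3 (conic (grid 0 pi M (Suc k)))) < 0" for n k
      unfolding unit_conic_def by (intro open_lune_normalize conic_nonzero)
    have int: "integrable lebesgue (indicator (?D k) :: _ \<Rightarrow> real)" for k
      using lmeasurable_open_lune unfolding fmeasurable_def
      by (intro integrable_real_indicator) blast+
    have "measure lebesgue (?D k) = lune_const *
        arccos (unit_conic (grid 0 pi M k) \<bullet> unit_conic (grid 0 pi M (Suc k)))" for k
    proof -
      have nz: "vec3 (unit_conic \<beta>) \<noteq> 0" for \<beta>
        using unit[of \<beta>] by (metis norm_vec3 norm_zero zero_neq_one)
      show ?thesis
        unfolding measure_open_lune[OF nz nz] by (subst measure_lune) (simp_all add: unit)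
    qed
    then have "lune_const * ?A M = (\<Sum>k<M. measure lebesgue (?D k))"
      by (simp only: sum_distrib_left)
    also have "\<dots> = (\<Sum>k<M. LINT n|lebesgue. indicator (?D k) n)"
      by simp
    also have "\<dots> = (LINT n|lebesgue. (\<Sum>k<M. indicator (?D k) n))"
      by (rule Bochner_Integration.integral_sum[symmetric]) (rule int)
    also have "\<dots> \<le> (LINT n|lebesgue. 2 * indicator hyperbolic_normals n)"
    proof (rule integral_mono)
      show "integrable lebesgue (\<lambda>n. \<Sum>k<M. indicator (?D k) n :: real)"
        by (intro Bochner_Integration.integrable_sum int)
      show "integrable lebesgue (\<lambda>n. 2 * indicator hyperbolic_normals n :: real)"
        using lmeasurable_hyperbolic_normals unfolding fmeasurable_def
        by (intro integrable_mult_right integrable_real_indicator) blast+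
      fix n :: "real^3"
      have eq: "(\<Sum>k<M. indicator (?D k) n :: real) = card {k. k < M \<and> n \<in> ?D k}"
        by (simp add: indicator_def sum.If_cases Collect_conj_eq lessThan_def)
      show "(\<Sum>k<M. indicator (?D k) n :: real) \<le> 2 * indicator hyperbolic_normals n"
      proof (cases "n \<in> hyperbolic_normals")
        case True
        have "card {k. k < M \<and> n \<in> ?D k} \<le> 2"
          using card_sign_changes_conic[of M n] True by (simp add: D hyperbolic_normals_def)
        then show ?thesis
          using True eq by simp
      next
        case False
        have "n \<notin> ?D k" for k
          using elliptic_form_semidefinite[of n] False unfolding D hyperbolic_normals_def
          by (auto simp: not_less)
        then show ?thesis
          using False by simp
      qed
    qed
    also have "\<dots> = 2 * measure lebesgue hyperbolic_normals"
      by simp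
    finally show ?thesis .
  qed
  have "(\<lambda>M. lune_const * ?A M) \<longlonglongrightarrow> lune_const * L_Omega"
    by (intro tendsto_intros lim)
  then show ?thesis
    by (rule LIMSEQ_le_const2) (use bound in blast)
qed

section \<open>Solutions of the differential equation\<close>

lemma second_order_sign_changes:
  fixes y y1 y2 :: "real \<Rightarrow> real"
  assumes y: "\<And>s. s \<in> {a..b} \<Longrightarrow> (y has_real_derivative y1 s) (at s within {a..b})"
    and y1: "\<And>s. s \<in> {a..b} \<Longrightarrow> (y1 has_real_derivative y2 s) (at s within {a..b})"
    and fin: "finite {s \<in> {a..b}. y s = 0}"
    and disc: "4 * c0 * c2 < c1\<^sup>2"
  shows "sign_changes (\<lambda>s. c0 * y s + c1 * y1 s + c2 * y2 s) a b (card {s \<in> {a..b}. y s = 0} - 2)"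
proof -
  let ?N = "card {s \<in> {a..b}. y s = 0}"
  have first: "sign_changes (\<lambda>s. y1 s - l * y s) a b (?N - 1)" for l
    by (rule Rolle_sign_changes[OF y finite_zeros_imp_separated[OF fin]])
  show ?thesis
  proof (cases "c2 = 0")
    case True
    \<comment> \<open>One root is at infinity: the form is of first order, and a single use of
      Rolle's theorem suffices.\<close>
    with disc have "c1 \<noteq> 0" by auto
    have "sign_changes (\<lambda>s. c1 * (y1 s - (- c0 / c1) * y s)) a b (?N - 1)"
      using \<open>c1 \<noteq> 0\<close> by (intro sign_changes_mult first) (auto simp: zero_less_mult_iff linorder_neq_iff)
    moreover have "(\<lambda>s. c1 * (y1 s - (- c0 / c1) * y s)) = (\<lambda>s. c0 * y s + c1 * y1 s + c2 * y2 s)"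
      using \<open>c1 \<noteq> 0\<close> True by (auto simp: fun_eq_iff field_simps)
    ultimately show ?thesis
      by (auto intro: sign_changes_mono)
  next
    case False
    define d where "d = sqrt (c1\<^sup>2 - 4 * c0 * c2)"
    have d: "d\<^sup>2 = c1\<^sup>2 - 4 * c0 * c2"
      using disc by (simp add: d_def)
    \<comment> \<open>The roots of c2 r^2 + c1 r + c0, real because of \<open>disc\<close>.\<close>
    define l m where "l = (- c1 + d) / (2 * c2)" and "m = (- c1 - d) / (2 * c2)"
    have lm: "c2 * (l + m) = - c1" "c2 * (l * m) = c0"
    proof -
      show "c2 * (l + m) = - c1"
        using False by (simp add: l_def m_def field_simps)
      have "l * m = (c1\<^sup>2 - d\<^sup>2) / (4 * c2\<^sup>2)"
        using False by (simp add: l_def m_def field_simps power2_eq_square)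
      then show "c2 * (l * m) = c0"
        using False unfolding d by (simp add: power2_eq_square)
    qed
    have der: "((\<lambda>s. y1 s - l * y s) has_real_derivative (y2 s - l * y1 s)) (at s within {a..b})"
      if "s \<in> {a..b}" for s
      by (intro DERIV_diff DERIV_cmult y y1 that)
    have "separated_zeros (\<lambda>s. y1 s - l * y s) a b (?N - 1)"
      by (rule sign_changes_imp_zeros[OF DERIV_continuous_on[OF der] first])
    from Rolle_sign_changes[OF der this, of m]
    have "sign_changes (\<lambda>s. c2 * ((y2 s - l * y1 s) - m * (y1 s - l * y s))) a b (?N - 1 - 1)"
      using False by (intro sign_changes_mult) (auto simp: zero_less_mult_iff linorder_neq_iff)
    moreover have "c2 * ((y2 s - l * y1 s) - m * (y1 s - l * y s)) = c0 * y s + c1 * y1 s + c2 * y2 s" for s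
    proof -
      have "c2 * ((y2 s - l * y1 s) - m * (y1 s - l * y s))
          = c2 * (l * m) * y s - c2 * (l + m) * y1 s + c2 * y2 s"
        by (simp add: algebra_simps)
      then show ?thesis
        unfolding lm by simp
    qed
    ultimately show ?thesis
      by (simp add: numeral_2_eq_2)
  qed
qed

text \<open>The number of grid steps crossed by the plane of \<open>n\<close>, integrated over the
  ball, is \<open>lune_const\<close> times the angle sum of the inscribed polygon. For
  \<open>n\<close> in \<open>S\<close> this number is eventually at least \<open>m\<close>, but from
  which grid on depends on \<open>n\<close>; Fatou's lemma copes with this lack of
  uniformity.\<close>

lemma sign_changes_measure_le_length:
  fixes f f' :: "real \<Rightarrow> real \<times> real \<times> real"
  assumes ab: "a < b"
    and der: "\<And>s. s \<in> {a..b} \<Longrightarrow> (f has_vector_derivative f' s) (at s within {a..b})"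
    and cont: "continuous_on {a..b} f'"
    and unit: "\<And>s. s \<in> {a..b} \<Longrightarrow> norm (f s) = 1"
    and S: "S \<in> lmeasurable" "S \<subseteq> ball 0 1"
    and sc: "\<And>n. n \<in> S \<Longrightarrow> sign_changes (\<lambda>s. n \<bullet> vec3 (f s)) a b m"
  shows "real m * measure lebesgue S \<le> lune_const * integral {a..b} (\<lambda>u. norm (f' u))"
proof -
  let ?L = "integral {a..b} (\<lambda>u. norm (f' u))"
  let ?D = "\<lambda>M k. lune (vec3 (f (grid a b M k))) (vec3 (f (grid a b M (Suc k))))"
  let ?A = "\<lambda>M. \<Sum>k<M. arccos (f (grid a b M k) \<bullet> f (grid a b M (Suc k)))"
  let ?u = "\<lambda>M n. \<Sum>k<M. indicator (?D M k) n :: ennreal"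
  have L: "0 \<le> ?L"
    by (intro integral_nonneg integrable_continuous_real continuous_intros cont) auto
  have sets: "?D M k \<in> sets lebesgue" for M k
    by (rule fmeasurableD) simp
  have "(\<integral>\<^sup>+ n. ?u M n \<partial>lebesgue) = ennreal (lune_const * ?A M)" for M
  proof -
    have node: "norm (f (grid a b M k)) = 1 \<and> norm (f (grid a b M (Suc k))) = 1" if "k < M" for k
      using that grid_bounds[of a b k M] grid_bounds[of a b "Suc k" M] ab by (intro conjI unit) auto
    have "(\<integral>\<^sup>+ n. ?u M n \<partial>lebesgue) = (\<Sum>k<M. emeasure lebesgue (?D M k))"
      using sets by (simp add: nn_integral_sum)
    also have "\<dots> = (\<Sum>k<M. ennreal (measure lebesgue (?D M k)))"
      by (intro sum.cong refl emeasure_eq_measure2) simp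
    also have "\<dots> = ennreal (\<Sum>k<M. measure lebesgue (?D M k))"
      by (rule sum_ennreal) simp
    also have "(\<Sum>k<M. measure lebesgue (?D M k)) = lune_const * ?A M"
      unfolding sum_distrib_left using node by (intro sum.cong refl) (simp add: measure_lune)
    finally show ?thesis .
  qed
  then have int: "(\<lambda>M. \<integral>\<^sup>+ n. ?u M n \<partial>lebesgue) = (\<lambda>M. ennreal (lune_const * ?A M))"
    by (rule ext)
  have "?A \<longlonglongrightarrow> ?L"
    by (rule angle_sum_tendsto_length[OF ab der cont unit])
  then have lim: "(\<lambda>M. ennreal (lune_const * ?A M)) \<longlonglongrightarrow> ennreal (lune_const * ?L)"
    by (intro tendsto_ennrealI tendsto_intros)
  have fc: "continuous_on {a..b} f"
    using der by (intro continuous_on_vector_derivative) auto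
  have pointwise: "ennreal (real m) * indicator S n \<le> liminf (\<lambda>M. ?u M n)" for n
  proof (cases "n \<in> S")
    case True
    have "continuous_on {a..b} (\<lambda>s. n \<bullet> vec3 (f s))"
    proof -
      have "n \<bullet> vec3 (f s) = (n $ 1, n $ 2, n $ 3) \<bullet> f s" for s
        by (simp add: inner_prod_def vec3_def inner_vec_def sum_3)
      then show ?thesis
        by (simp only:) (intro continuous_intros fc)
    qed
    from eventually_grid_sign_changes[OF this sc[OF True]]
    have "\<forall>\<^sub>F M in sequentially. ennreal (real m) \<le> ?u M n"
    proof eventually_elim
      case (elim M)
      have "?u M n = of_nat (card {k. k < M \<and> n \<in> ?D M k})"
        by (simp add: indicator_def sum.If_cases Collect_conj_eq lessThan_def)
      also have "{k. k < M \<and> n \<in> ?D M k} = {k. k < M \<and>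
          (n \<bullet> vec3 (f (grid a b M k))) * (n \<bullet> vec3 (f (grid a b M (Suc k)))) \<le> 0}"
        using True S(2) by (auto simp: lune_def)
      finally show ?case
        using elim by (simp add: ennreal_of_nat_eq_real_of_nat)
    qed
    then have "ennreal (real m) \<le> liminf (\<lambda>M. ?u M n)"
      by (rule Liminf_bounded)
    then show ?thesis
      using True by simp
  qed simp
  have "ennreal (real m * measure lebesgue S) = ennreal (real m) * emeasure lebesgue S"
    using S(1) by (simp add: emeasure_eq_measure2 ennreal_mult)
  also have "\<dots> = (\<integral>\<^sup>+ n. ennreal (real m) * indicator S n \<partial>lebesgue)"
    using fmeasurableD[OF S(1)] by (simp add: nn_integral_cmult_indicator)
  also have "\<dots> \<le> (\<integral>\<^sup>+ n. liminf (\<lambda>M. ?u M n) \<partial>lebesgue)"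
    by (intro nn_integral_mono pointwise)
  also have "\<dots> \<le> liminf (\<lambda>M. \<integral>\<^sup>+ n. ?u M n \<partial>lebesgue)"
    using sets by (intro nn_integral_liminf) simp
  also have "\<dots> = ennreal (lune_const * ?L)"
    unfolding int by (rule lim_imp_Liminf[OF _ lim]) simp
  finally show ?thesis
    using L lune_const_pos by (simp add: ennreal_le_iff)
qed

section \<open>Nonvanishing of the phase vector\<close>

lemma DERIV_within_nonneg_imp_le:
  fixes f :: "real \<Rightarrow> real"
  assumes "\<And>s. s \<in> {u..v} \<Longrightarrow> (f has_real_derivative f' s) (at s within {u..v})"
    and "\<And>s. s \<in> {u..v} \<Longrightarrow> 0 \<le> f' s" and "u \<le> v"
  shows "f u \<le> f v"
proof (cases "u = v")
  case False
  then have "\<exists>s\<in>{u<..<v}. f v - f u = f' s * (v - u)"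
    using assms by (intro mvt_simple) (auto simp: has_field_derivative_def)
  then obtain s where s: "s \<in> {u<..<v}" "f v - f u = f' s * (v - u)"
    by blast
  then have "0 \<le> f' s * (v - u)"
    using assms by (intro mult_nonneg_nonneg) auto
  with s show ?thesis by simp
qed simp

text \<open>As the bound is two-sided, exp(K r) e(r) is nondecreasing and exp(-K r) e(r)
  nonincreasing. The first spreads the zero at \<open>s\<close> to the left, the second to the
  right.\<close>

lemma Gronwall_zero:
  fixes e e' :: "real \<Rightarrow> real"
  assumes der: "\<And>s. s \<in> {a..b} \<Longrightarrow> (e has_real_derivative e' s) (at s within {a..b})"
    and bound: "\<And>s. s \<in> {a..b} \<Longrightarrow> \<bar>e' s\<bar> \<le> K * e s"
    and nonneg: "\<And>s. 0 \<le> e s"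
    and s: "s \<in> {a..b}" "e s = 0" and t: "t \<in> {a..b}"
  shows "e t = 0"
proof -
  have exp_der: "((\<lambda>r. exp (c * r) * e r) has_real_derivative exp (c * r) * (c * e r + e' r)) (at r within {u..v})"
    if "{u..v} \<subseteq> {a..b}" "r \<in> {u..v}" for c u v r
    using that by (auto intro!: derivative_eq_intros has_field_derivative_subset[OF der] simp: algebra_simps)
  have "e t \<le> 0"
  proof (cases "t \<le> s")
    case True
    have sub: "{t..s} \<subseteq> {a..b}"
      using s t by auto
    have "exp (K * t) * e t \<le> exp (K * s) * e s"
    proof (rule DERIV_within_nonneg_imp_le[where f = "\<lambda>r. exp (K * r) * e r", OF exp_der[OF sub] _ True])
      fix r assume "r \<in> {t..s}"
      then have "r \<in> {a..b}"
        using sub by blast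
      from bound[OF this] show "0 \<le> exp (K * r) * (K * e r + e' r)"
        by (intro mult_nonneg_nonneg) (auto simp: abs_le_iff)
    qed
    then show ?thesis
      using s(2) by (simp add: mult_le_0_iff)
  next
    case False
    then have "s \<le> t" by simp
    have sub: "{s..t} \<subseteq> {a..b}"
      using s t by auto
    have "- (exp (- K * s) * e s) \<le> - (exp (- K * t) * e t)"
    proof (rule DERIV_within_nonneg_imp_le[where f = "\<lambda>r. - (exp (- K * r) * e r)",
          OF DERIV_minus[OF exp_der[OF sub]] _ \<open>s \<le> t\<close>])
      fix r assume "r \<in> {s..t}"
      then have "r \<in> {a..b}"
        using sub by blast
      from bound[OF this] have "- K * e r + e' r \<le> 0"
        by (auto simp: abs_le_iff)
      then show "0 \<le> - (exp (- K * r) * (- K * e r + e' r))"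
        by (simp add: mult_le_0_iff)
    qed
    then show ?thesis
      using s(2) by (simp add: mult_le_0_iff)
  qed
  with nonneg[of t] show ?thesis by simp
qed

text \<open>The left side is the derivative of y^2 + y'^2 + y''^2 with y''' eliminated by the
  equation. Each product is bounded by 2|uv| \<le> u^2 + v^2; the 4 stems from \<open>y2\<close>,
  whose square arises twice from the \<open>a\<close> term and once each from those of
  \<open>b\<close> and \<open>c\<close>.\<close>

lemma energy_estimate:
  fixes a b c A y0 y1 y2 :: real
  assumes "\<bar>a\<bar> \<le> A" "\<bar>b\<bar> \<le> A" "\<bar>c\<bar> \<le> A"
  shows "\<bar>2 * (y0 * y1 + y1 * y2 + y2 * - (a * y2 + b * y1 + c * y0))\<bar>
    \<le> (2 + 4 * A) * (y0\<^sup>2 + y1\<^sup>2 + y2\<^sup>2)"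
proof -
  have prod: "2 * \<bar>u * v\<bar> \<le> u\<^sup>2 + v\<^sup>2" for u v :: real
    using sum_squares_bound[of "\<bar>u\<bar>" "\<bar>v\<bar>"] by (simp add: abs_mult)
  have "0 \<le> A" using assms(1) by linarith
  have coeff: "2 * \<bar>d * (u * v)\<bar> \<le> A * (u\<^sup>2 + v\<^sup>2)" if "\<bar>d\<bar> \<le> A" for d u v :: real
  proof -
    have "2 * \<bar>d * (u * v)\<bar> = \<bar>d\<bar> * (2 * \<bar>u * v\<bar>)"
      by (simp add: abs_mult)
    also have "\<dots> \<le> A * (u\<^sup>2 + v\<^sup>2)"
      using that \<open>0 \<le> A\<close> prod by (intro mult_mono) auto
    finally show ?thesis .
  qed
  have "2 * (y0 * y1 + y1 * y2 + y2 * - (a * y2 + b * y1 + c * y0))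
      = 2 * (y0 * y1) + 2 * (y1 * y2) - 2 * (a * (y2 * y2)) - 2 * (b * (y1 * y2)) - 2 * (c * (y0 * y2))"
    by (simp add: algebra_simps)
  also have "\<bar>\<dots>\<bar> \<le> 2 * \<bar>y0 * y1\<bar> + 2 * \<bar>y1 * y2\<bar> + 2 * \<bar>a * (y2 * y2)\<bar>
      + 2 * \<bar>b * (y1 * y2)\<bar> + 2 * \<bar>c * (y0 * y2)\<bar>"
    by linarith
  also have "\<dots> \<le> (y0\<^sup>2 + y1\<^sup>2) + (y1\<^sup>2 + y2\<^sup>2) + A * (y2\<^sup>2 + y2\<^sup>2) + A * (y1\<^sup>2 + y2\<^sup>2) + A * (y0\<^sup>2 + y2\<^sup>2)"
    by (intro add_mono prod coeff assms)
  also have "\<dots> \<le> (2 + 4 * A) * (y0\<^sup>2 + y1\<^sup>2 + y2\<^sup>2)"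
  proof -
    have "(2 + 4 * A) * (y0\<^sup>2 + y1\<^sup>2 + y2\<^sup>2) - ((y0\<^sup>2 + y1\<^sup>2) + (y1\<^sup>2 + y2\<^sup>2) + A * (y2\<^sup>2 + y2\<^sup>2)
        + A * (y1\<^sup>2 + y2\<^sup>2) + A * (y0\<^sup>2 + y2\<^sup>2)) = y0\<^sup>2 + y2\<^sup>2 + A * (3 * y0\<^sup>2 + 3 * y1\<^sup>2)"
      by (simp add: algebra_simps)
    moreover have "0 \<le> y0\<^sup>2 + y2\<^sup>2 + A * (3 * y0\<^sup>2 + 3 * y1\<^sup>2)"
      using \<open>0 \<le> A\<close> by (intro add_nonneg_nonneg mult_nonneg_nonneg) auto
    ultimately show ?thesis by linarith
  qed
  finally show ?thesis .
qed

text \<open>Uniqueness for the initial value problem: the squared norm e of the phase vector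
  satisfies |e'| \<le> K e on compact intervals, so a single zero of it would make the solution
  vanish identically. This legitimises the projection to the sphere.\<close>

lemma phase3_nonzero:
  fixes a b c y y1 y2 y3 :: "real \<Rightarrow> real"
  assumes cont: "continuous_on {0..} a" "continuous_on {0..} b" "continuous_on {0..} c"
    and y: "\<And>t. t \<ge> 0 \<Longrightarrow> (y has_real_derivative y1 t) (at t within {0..})"
    and y1: "\<And>t. t \<ge> 0 \<Longrightarrow> (y1 has_real_derivative y2 t) (at t within {0..})"
    and y2: "\<And>t. t \<ge> 0 \<Longrightarrow> (y2 has_real_derivative y3 t) (at t within {0..})"
    and ode: "\<And>t. t \<ge> 0 \<Longrightarrow> y3 t + a t * y2 t + b t * y1 t + c t * y t = 0"
    and nontriv: "\<exists>t\<ge>0. y t \<noteq> 0"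
    and "s \<ge> 0"
  shows "phase3 y y1 y2 s \<noteq> 0"
proof
  assume zero: "phase3 y y1 y2 s = 0"
  obtain t where t: "t \<ge> 0" "y t \<noteq> 0"
    using nontriv by blast
  \<comment> \<open>The point \<open>t\<close> with \<open>y t \<noteq> 0\<close> may lie on either
    side of \<open>s\<close>; the interval has to contain both.\<close>
  define T where "T = max s t"
  have bdd: "\<exists>B. \<forall>r\<in>{0..T}. \<bar>h r\<bar> \<le> B" if "continuous_on {0..} h" for h :: "real \<Rightarrow> real"
  proof -
    have "continuous_on {0..T} h"
      by (rule continuous_on_subset[OF that]) auto
    then have "bounded (h ` {0..T})"
      by (intro compact_imp_bounded compact_continuous_image) auto
    then show ?thesis
      unfolding bounded_iff by simp
  qed
  obtain Ba Bb Bc where B: "\<forall>r\<in>{0..T}. \<bar>a r\<bar> \<le> Ba" "\<forall>r\<in>{0..T}. \<bar>b r\<bar> \<le> Bb" "\<forall>r\<in>{0..T}. \<bar>c r\<bar> \<le> Bc"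
    using bdd cont by metis
  define A where "A = max Ba (max Bb Bc)"
  have A: "\<bar>a r\<bar> \<le> A" "\<bar>b r\<bar> \<le> A" "\<bar>c r\<bar> \<le> A" if "r \<in> {0..T}" for r
    using B that unfolding A_def by (auto simp: le_max_iff_disj)
  define e where "e = (\<lambda>r. (y r)\<^sup>2 + (y1 r)\<^sup>2 + (y2 r)\<^sup>2)"
  define e' where "e' = (\<lambda>r. 2 * (y r * y1 r + y1 r * y2 r + y2 r * y3 r))"
  have "e t = 0"
  proof (rule Gronwall_zero[of 0 T e e' "2 + 4 * A" s t])
    fix r assume r: "r \<in> {0..T}"
    have sub: "{0..T} \<subseteq> {0..}" by auto
    have r0: "r \<ge> 0" using r by simp
    note der = y[OF r0, THEN has_field_derivative_subset, OF sub]
      y1[OF r0, THEN has_field_derivative_subset, OF sub]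
      y2[OF r0, THEN has_field_derivative_subset, OF sub]
    show "(e has_real_derivative e' r) (at r within {0..T})"
      unfolding e_def e'_def by (auto intro!: derivative_eq_intros der simp: algebra_simps)
    have "y3 r = - (a r * y2 r + b r * y1 r + c r * y r)"
      using ode[OF r0] by linarith
    then show "\<bar>e' r\<bar> \<le> (2 + 4 * A) * e r"
      unfolding e'_def e_def using energy_estimate[OF A[OF r]] by simp
  next
    show "e s = 0"
      using zero by (simp add: e_def phase3_def zero_prod_def)
  qed (use t \<open>s \<ge> 0\<close> in \<open>auto simp: e_def T_def\<close>)
  then have "(y t)\<^sup>2 = 0"
    unfolding e_def using zero_le_power2[of "y t"] zero_le_power2[of "y1 t"] zero_le_power2[of "y2 t"] by linarith
  then show False
    using t by simp
qed

theorem theorem1: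
  fixes a b c y y1 y2 y3 :: "real \<Rightarrow> real"
  assumes "continuous_on {0..} a" and "continuous_on {0..} b" and "continuous_on {0..} c"
    and "\<And>t. t \<ge> 0 \<Longrightarrow> (y has_real_derivative y1 t) (at t within {0..})"
    and "\<And>t. t \<ge> 0 \<Longrightarrow> (y1 has_real_derivative y2 t) (at t within {0..})"
    and "\<And>t. t \<ge> 0 \<Longrightarrow> (y2 has_real_derivative y3 t) (at t within {0..})"
    and "\<And>t. t \<ge> 0 \<Longrightarrow> y3 t + a t * y2 t + b t * y1 t + c t * y t = 0"
    and "\<exists>t\<ge>0. y t \<noteq> 0"
    and "t > 0"
  shows "gamma3 y y1 y2 t > (real (nu y t) - 5) / 2 * L_Omega"
proof -
  define x where "x = phase3 y y1 y2"
  define x' where "x' = phase3 y1 y2 y3"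
  have x: "x s \<noteq> 0" if "s \<ge> 0" for s
    unfolding x_def by (rule phase3_nonzero[OF assms(1-8) that])
  have sub: "{0..t} \<subseteq> {0..}" by auto
  have y: "(y has_real_derivative y1 s) (at s within {0..t})"
    and y1: "(y1 has_real_derivative y2 s) (at s within {0..t})"
    and y2: "(y2 has_real_derivative y3 s) (at s within {0..t})" if "s \<in> {0..t}" for s
  proof -
    have "s \<ge> 0" using that by simp
    note * = assms(4-6)[OF this, THEN has_field_derivative_subset, OF sub]
    from * show "(y has_real_derivative y1 s) (at s within {0..t})"
      "(y1 has_real_derivative y2 s) (at s within {0..t})"
      "(y2 has_real_derivative y3 s) (at s within {0..t})" .
  qed
  have cont: "continuous_on {0..t} y" "continuous_on {0..t} y1" "continuous_on {0..t} y2"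
    using DERIV_continuous_on[OF y] DERIV_continuous_on[OF y1] DERIV_continuous_on[OF y2] by auto
  \<comment> \<open>The equation expresses \<open>y3\<close> through continuous functions, so the
    phase curve is continuously differentiable, as the polygon limit requires.\<close>
  have "continuous_on {0..t} (\<lambda>s. - (a s * y2 s + b s * y1 s + c s * y s))"
    by (intro continuous_intros cont continuous_on_subset[OF _ sub] assms)
  moreover have "- (a s * y2 s + b s * y1 s + c s * y s) = y3 s" if "s \<in> {0..t}" for s
    using assms(7)[of s] that by simp
  ultimately have "continuous_on {0..t} y3"
    by (rule continuous_on_eq)
  then have cont_x: "continuous_on {0..t} x" and cont_x': "continuous_on {0..t} x'"
    unfolding x_def x'_def phase3_def [abs_def] by (intro continuous_intros cont; assumption)+
  define f where "f = (\<lambda>s. x s /\<^sub>R norm (x s))"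
  define f' where "f' = (\<lambda>s. unit_deriv (x s) (x' s))"
  have der: "(f has_vector_derivative f' s) (at s within {0..t})" if "s \<in> {0..t}" for s
  proof -
    have "(x has_vector_derivative x' s) (at s within {0..t})"
      unfolding x_def x'_def phase3_def [abs_def]
      by (intro has_vector_derivative_Pair)
        (use y y1 y2 that in \<open>auto simp: has_real_derivative_iff_has_vector_derivative[symmetric]\<close>)
    then show ?thesis
      unfolding f_def f'_def using x that by (intro has_vector_derivative_normalized) auto
  qed
  have cont_f': "continuous_on {0..t} f'"
    unfolding f'_def using x by (intro continuous_on_unit_deriv cont_x cont_x') auto
  have unit: "norm (f s) = 1" if "s \<in> {0..t}" for s
    using x[of s] that by (simp add: f_def)
  have gamma: "gamma3 y y1 y2 t = integral {0..t} (\<lambda>s. norm (f' s))"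
    unfolding gamma3_def x_def[symmetric] f_def[symmetric]
    using vector_derivative_within_closed_interval[OF \<open>t > 0\<close> _ der] by (intro integral_cong) simp
  have "0 \<le> gamma3 y y1 y2 t"
    unfolding gamma by (intro integral_nonneg integrable_continuous_real continuous_intros cont_f') auto
  show ?thesis
  \<comment> \<open>Below two zeros the right side is negative. An infinite zero set lands here too,
    its \<open>card\<close> being 0; in the other case a positive \<open>card\<close> yields
    finiteness.\<close>
  proof (cases "nu y t < 2")
    case True
    then have "(real (nu y t) - 5) / 2 * L_Omega < 0"
      using L_Omega_pos by (intro mult_neg_pos) auto
    with \<open>0 \<le> gamma3 y y1 y2 t\<close> show ?thesis by linarith
  next
    case False
    then have fin: "finite {s \<in> {0..t}. y s = 0}"
      by (intro card_ge_0_finite) (simp add: nu_def)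
    have "real (nu y t - 2) * measure lebesgue hyperbolic_normals \<le> lune_const * gamma3 y y1 y2 t"
      unfolding gamma
    proof (rule sign_changes_measure_le_length[OF \<open>t > 0\<close> der cont_f' unit])
      show "hyperbolic_normals \<subseteq> ball 0 1"
        by (auto simp: hyperbolic_normals_def)
      fix n assume n: "n \<in> hyperbolic_normals"
      have "sign_changes (\<lambda>s. n $ 1 * y s + n $ 2 * y1 s + n $ 3 * y2 s) 0 t (nu y t - 2)"
        unfolding nu_def using n
        by (intro second_order_sign_changes[OF y y1 fin]) (auto simp: hyperbolic_normals_def)
      \<comment> \<open>Projection to the sphere divides by |x| > 0 and so keeps all signs.\<close>
      then have "sign_changes (\<lambda>s. inverse (norm (x s)) * (n $ 1 * y s + n $ 2 * y1 s + n $ 3 * y2 s)) 0 t (nu y t - 2)"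
        using x by (intro sign_changes_mult) auto
      then show "sign_changes (\<lambda>s. n \<bullet> vec3 (f s)) 0 t (nu y t - 2)"
        by (simp add: f_def x_def phase3_def inner_vec3 del: scaleR_Pair)
    qed (assumption | rule lmeasurable_hyperbolic_normals)+
    moreover have "real (nu y t - 2) * (lune_const * L_Omega) \<le> real (nu y t - 2) * (2 * measure lebesgue hyperbolic_normals)"
      by (intro mult_left_mono lune_const_L_Omega_le) simp
    moreover have "real (nu y t - 2) * (2 * measure lebesgue hyperbolic_normals)
        = 2 * (real (nu y t - 2) * measure lebesgue hyperbolic_normals)"
      by (rule mult.left_commute)
    moreover have "lune_const * (real (nu y t - 2) / 2 * L_Omega)
        = real (nu y t - 2) * (lune_const * L_Omega) / 2"
      by simp
    ultimately have "lune_const * (real (nu y t - 2) / 2 * L_Omega) \<le> lune_const * gamma3 y y1 y2 t"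
      by linarith
    then have "real (nu y t - 2) / 2 * L_Omega \<le> gamma3 y y1 y2 t"
      using lune_const_pos by simp
    \<comment> \<open>The surplus of 3/2 times \<open>L_Omega\<close> makes the inequality
      strict.\<close>
    moreover have "(real (nu y t) - 5) / 2 * L_Omega < real (nu y t - 2) / 2 * L_Omega"
      using False L_Omega_pos by (intro mult_strict_right_mono) auto
    ultimately show ?thesis by linarith
  qed
qed

end
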